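(* Let $X$ and $Y$ be operator spaces and assume that $X$ almost completely Lipschitzly embeds into $Y^*$. Then $X$ almost completely $\mathbb{C}$-linearly embeds into $Y^*\oplus \overline{Y}^*$.
   Context: All operator spaces are over the complex field: an operator space is a closed $\mathbb{C}$-linear subspace $X\subset \mathcal{B}(H)$ for a (complex) Hilbert space $H$; $\mathrm{M}_n(X)$ carries the norm inherited from $\mathcal{B}(H^{\oplus n})$. The dual $Y^*$ of an operator space $Y$ is an operator space via $\mathrm{M}_n(Y^* )\cong \mathrm{CB}(Y,\mathrm{M}_n)$ (completely bounded maps with the cb-norm). The conjugate $\overline{Y}$ of $Y\subset\mathcal{B}(H)$ is the set $Y$ with the same addition and with scalar multiplication $\alpha\cdot y=\bar\alpha y$, with the operator space structure given by the canonical inclusion $\overline{Y}\subset\overline{\mathcal{B}(H)}=\mathcal{B}(\overline{H})$; $\overline{Y}^*$ denotes its dual. The direct sum of operator spaces carries the usual ($\ell_\infty$-sum) operator space structure. For a map $f:X\to Z$ between operator spaces (not necessarily linear), the $n$-th amplification is $f_n:\mathrm{M}_n(X)\to \mathrm{M}_n(Z)$, $f_n([x_{ij}])=[f(x_{ij})]$. The Lipschitz distortion of an injective map $g$ between metric spaces $(A,d)$ and $(B,\partial)$ is the infimum of all $D>0$ for which there is $r>0$ with $r\,d(x,y)\le \partial(g(x),g(y))\le Dr\,d(x,y)$ for all $x,y\in A$; $g$ is a Lipschitz embedding if it is injective, Lipschitz and $g^{-1}:g(A)\to A$ is Lipschitz. $X$ almost completely Lipschitzly embeds into $Z$ if there are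 $D>0$ and a sequence of (arbitrary) maps $(f^n:X\to Z)_{n\in\mathbb{N}}$ such that for each $n$ the $n$-th amplification $f^n_n:\mathrm{M}_n(X)\to\mathrm{M}_n(Z)$ of $f^n$ is a Lipschitz embedding with distortion at most $D$. $X$ almost completely $\mathbb{C}$-linearly embeds (equivalently, almost completely $\mathbb{C}$-isomorphically embeds) into $Z$ if there are such a $D$ and such a sequence in which, in addition, each $f^n$ is $\mathbb{C}$-linear. *)

theory Defs
  imports "HOL-Analysis.Analysis" "HOL-Library.Function_Algebras"
begin

section \<open>Complex Hilbert spaces and their bounded operators\<close>

text \<open>
  The underlying real Banach space is the one supplied by the type class; the complex structure
  is an explicit parameter, so that a Hilbert space and its conjugate live on the same type.
  The inner product is linear in its first argument.
\<close>

locale complex_hilbert_space = vector_space smul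
  for smul :: "complex \<Rightarrow> 'h::banach \<Rightarrow> 'h" +
  fixes ip :: "'h \<Rightarrow> 'h \<Rightarrow> complex"
  assumes smul_of_real: "smul (complex_of_real r) x = r *\<^sub>R x"
    and ip_add_left: "ip (x + y) z = ip x z + ip y z"
    and ip_smul_left: "ip (smul a x) y = a * ip x y"
    and ip_commute: "ip y x = cnj (ip x y)"
    and ip_self: "ip x x = complex_of_real ((norm x)\<^sup>2)"

definition conj_smul :: "(complex \<Rightarrow> 'h \<Rightarrow> 'h) \<Rightarrow> complex \<Rightarrow> 'h \<Rightarrow> 'h" where
  "conj_smul smul a x = smul (cnj a) x"

lemma complex_hilbert_space_conj:
  assumes "complex_hilbert_space smul ip"
  shows "complex_hilbert_space (conj_smul smul) (\<lambda>x y. ip y x)"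
proof -
  interpret complex_hilbert_space smul ip by fact
  show ?thesis
  proof
    fix a b :: complex and x y z :: 'a and r :: real
    show "conj_smul smul a (x + y) = conj_smul smul a x + conj_smul smul a y"
      by (simp add: conj_smul_def scale_right_distrib)
    show "conj_smul smul (a + b) x = conj_smul smul a x + conj_smul smul b x"
      by (simp add: conj_smul_def scale_left_distrib)
    show "conj_smul smul a (conj_smul smul b x) = conj_smul smul (a * b) x"
      by (simp add: conj_smul_def)
    show "conj_smul smul 1 x = x"
      by (simp add: conj_smul_def)
    show "conj_smul smul (complex_of_real r) x = r *\<^sub>R x"
      by (simp add: conj_smul_def smul_of_real)
    show "ip z (x + y) = ip z x + ip z y"
      by (metis ip_commute ip_add_left complex_cnj_add)
    show "ip y (conj_smul smul a x) = a * ip y x"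
      by (metis conj_smul_def ip_commute ip_smul_left complex_cnj_mult complex_cnj_cnj)
    show "ip x y = cnj (ip y x)"
      by (rule ip_commute)
    show "ip x x = complex_of_real ((norm x)\<^sup>2)"
      by (rule ip_self)
  qed
qed

definition bounded_operators :: "(complex \<Rightarrow> 'h::banach \<Rightarrow> 'h) \<Rightarrow> ('h \<Rightarrow>\<^sub>L 'h) set" where
  "bounded_operators smul = {T. Vector_Spaces.linear smul smul (blinfun_apply T)}"

definition op_smul ::
  "(complex \<Rightarrow> 'h::banach \<Rightarrow> 'h) \<Rightarrow> complex \<Rightarrow> ('h \<Rightarrow>\<^sub>L 'h) \<Rightarrow> ('h \<Rightarrow>\<^sub>L 'h)" where
  "op_smul smul a T = Blinfun (\<lambda>\<xi>. smul a (blinfun_apply T \<xi>))"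

text \<open>The topology on \<^typ>\<open>'h \<Rightarrow>\<^sub>L 'h\<close> is that of the operator norm.\<close>

definition operator_space :: "(complex \<Rightarrow> 'h::banach \<Rightarrow> 'h) \<Rightarrow> ('h \<Rightarrow>\<^sub>L 'h) set \<Rightarrow> bool" where
  "operator_space smul X \<longleftrightarrow>
     X \<subseteq> bounded_operators smul \<and> module.subspace (op_smul smul) X \<and> closed X"

text \<open>
  Norm of the operator matrix \<open>A\<close>, with finite index set \<open>I\<close>, acting on the Hilbert space
  direct sum of copies of \<open>'h\<close> indexed by \<open>I\<close>.
\<close>

definition matrix_opnorm :: "'i set \<Rightarrow> ('i \<Rightarrow> 'i \<Rightarrow> 'h::real_normed_vector \<Rightarrow> 'h) \<Rightarrow> real" where
  "matrix_opnorm I A =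
     (SUP \<xi>\<in>{\<xi>. (\<Sum>j\<in>I. (norm (\<xi> j))\<^sup>2) \<le> 1}.
        sqrt (\<Sum>i\<in>I. (norm (\<Sum>j\<in>I. A i j (\<xi> j)))\<^sup>2))"


section \<open>Operator space structures\<close>

text \<open>
  A complex vector space, carried by a subset of an additive group, with norms on its matrices.
  Addition is that of the type; the scalar multiplication is part of the structure.
\<close>

record 'a matrix_normed =
  os_carrier :: "'a set"
  os_smul :: "complex \<Rightarrow> 'a \<Rightarrow> 'a"
  os_norm :: "nat \<Rightarrow> (nat \<Rightarrow> nat \<Rightarrow> 'a) \<Rightarrow> real"

text \<open>
  An \<open>n \<times> n\<close> matrix is a function on pairs of naturals vanishing outside the index range,
  so that equality of matrices is equality of functions.
\<close>

definition matrices :: "nat \<Rightarrow> ('a::ab_group_add) matrix_normed \<Rightarrow> (nat \<Rightarrow> nat \<Rightarrow> 'a) set" where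
  "matrices n V =
     {x. (\<forall>i<n. \<forall>j<n. x i j \<in> os_carrier V) \<and> (\<forall>i j. \<not> (i < n \<and> j < n) \<longrightarrow> x i j = 0)}"

definition matrix_dist ::
  "nat \<Rightarrow> ('a::ab_group_add) matrix_normed \<Rightarrow> (nat \<Rightarrow> nat \<Rightarrow> 'a) \<Rightarrow> (nat \<Rightarrow> nat \<Rightarrow> 'a) \<Rightarrow> real" where
  "matrix_dist n V x y = os_norm V n (x - y)"

text \<open>The case distinction matters since \<open>f\<close> need not map \<open>0\<close> to \<open>0\<close>.\<close>

definition amplification ::
  "nat \<Rightarrow> ('a \<Rightarrow> 'b::ab_group_add) \<Rightarrow> (nat \<Rightarrow> nat \<Rightarrow> 'a) \<Rightarrow> (nat \<Rightarrow> nat \<Rightarrow> 'b)" where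
  "amplification n f x = (\<lambda>i j. if i < n \<and> j < n then f (x i j) else 0)"

definition clinear_on ::
  "('a::ab_group_add) set \<Rightarrow> (complex \<Rightarrow> 'a \<Rightarrow> 'a) \<Rightarrow> (complex \<Rightarrow> 'b::ab_group_add \<Rightarrow> 'b)
    \<Rightarrow> ('a \<Rightarrow> 'b) \<Rightarrow> bool" where
  "clinear_on S s t f \<longleftrightarrow>
     (\<forall>x\<in>S. \<forall>y\<in>S. f (x + y) = f x + f y) \<and> (\<forall>a. \<forall>x\<in>S. f (s a x) = t a (f x))"

definition concrete_os ::
  "(complex \<Rightarrow> 'h::banach \<Rightarrow> 'h) \<Rightarrow> ('h \<Rightarrow>\<^sub>L 'h) set \<Rightarrow> ('h \<Rightarrow>\<^sub>L 'h) matrix_normed" where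
  "concrete_os smul X =
     \<lparr>os_carrier = X,
      os_smul = op_smul smul,
      os_norm = (\<lambda>n x. matrix_opnorm {..<n} (\<lambda>i j. blinfun_apply (x i j)))\<rparr>"

text \<open>
  The conjugate of an operator space: the same set of operators, now viewed inside the bounded
  operators on the conjugate Hilbert space (see the two lemmas on conjugates).
\<close>

definition conj_os ::
  "(complex \<Rightarrow> 'h::banach \<Rightarrow> 'h) \<Rightarrow> ('h \<Rightarrow>\<^sub>L 'h) set \<Rightarrow> ('h \<Rightarrow>\<^sub>L 'h) matrix_normed" where
  "conj_os smul X = concrete_os (conj_smul smul) X"

lemma op_smul_conj: "op_smul (conj_smul smul) a T = op_smul smul (cnj a) T"
  by (simp add: op_smul_def conj_smul_def)

lemma operator_space_conj:
  assumes hs: "complex_hilbert_space smul ip" and X: "operator_space smul X"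
  shows "operator_space (conj_smul smul) X"
proof -
  interpret V: complex_hilbert_space smul ip by fact
  interpret W: complex_hilbert_space "conj_smul smul" "\<lambda>x y. ip y x"
    by (rule complex_hilbert_space_conj[OF hs])
  have op_smul: "blinfun_apply (op_smul s a T) = (\<lambda>\<xi>. s a (blinfun_apply T \<xi>))"
    if "complex_hilbert_space s q" for s :: "complex \<Rightarrow> 'a \<Rightarrow> 'a" and q a T
  proof -
    interpret S: complex_hilbert_space s q by fact
    have norm_s: "norm (s a x) = cmod a * norm x" for a x
    proof -
      have "complex_of_real ((norm (s a x))\<^sup>2) = (a * cnj a) * q x x"
        by (metis S.ip_self S.ip_smul_left S.ip_commute complex_cnj_mult complex_cnj_cnj
            mult.assoc mult.commute)
      also have "\<dots> = complex_of_real ((cmod a * norm x)\<^sup>2)"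
        by (simp only: S.ip_self complex_mult_cnj cmod_power2[symmetric] power_mult_distrib
            of_real_mult)
      finally have "(norm (s a x))\<^sup>2 = (cmod a * norm x)\<^sup>2"
        by (simp only: of_real_eq_iff)
      then show ?thesis by (simp add: power2_eq_iff_nonneg)
    qed
    have "bounded_linear (s a)"
    proof (rule bounded_linear_intro)
      show "s a (x + y) = s a x + s a y" for x y by (rule S.scale_right_distrib)
      show "s a (r *\<^sub>R x) = r *\<^sub>R s a x" for r x
        by (metis S.smul_of_real S.scale_left_commute)
      show "norm (s a x) \<le> norm x * cmod a" for x
        by (simp add: norm_s mult.commute)
    qed
    then have "bounded_linear (\<lambda>\<xi>. s a (blinfun_apply T \<xi>))"
      by (rule bounded_linear_compose) (rule blinfun.bounded_linear_right)
    then show ?thesis by (simp add: op_smul_def bounded_linear_Blinfun_apply)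
  qed
  have mod: "module (op_smul s)"
    if "complex_hilbert_space s q" for s :: "complex \<Rightarrow> 'a \<Rightarrow> 'a" and q
  proof -
    interpret S: complex_hilbert_space s q by fact
    show ?thesis
      by (unfold_locales; rule blinfun_eqI)
        (simp_all add: op_smul[OF that] blinfun.add_left S.scale_right_distrib
          S.scale_left_distrib)
  qed
  have "module.subspace (op_smul (conj_smul smul)) X"
    using X mod[OF hs] mod[OF W.complex_hilbert_space_axioms]
    by (simp add: operator_space_def module.subspace_def op_smul_conj)
  moreover have "X \<subseteq> bounded_operators (conj_smul smul)"
  proof
    fix T assume "T \<in> X"
    then have "Vector_Spaces.linear smul smul (blinfun_apply T)"
      using X by (auto simp: operator_space_def bounded_operators_def)
    then interpret L: Vector_Spaces.linear smul smul "blinfun_apply T" .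
    show "T \<in> bounded_operators (conj_smul smul)"
      unfolding bounded_operators_def
      by (auto intro!: Vector_Spaces.linear.intro W.vector_space_axioms module_hom.intro
          W.module_axioms module_hom_axioms.intro simp: L.add L.scale conj_smul_def)
  qed
  ultimately show ?thesis using X by (simp add: operator_space_def)
qed

text \<open>The \<open>n \<times> n\<close> complex matrices as operators on \<open>\<complex>\<^sup>n\<close>; matrices over them are block matrices.\<close>

definition scalar_matrices_os :: "nat \<Rightarrow> (nat \<Rightarrow> nat \<Rightarrow> complex) matrix_normed" where
  "scalar_matrices_os n =
     \<lparr>os_carrier = {\<alpha>. \<forall>k l. \<not> (k < n \<and> l < n) \<longrightarrow> \<alpha> k l = 0},
      os_smul = (\<lambda>a \<alpha> k l. a * \<alpha> k l),
      os_norm = (\<lambda>m x. matrix_opnorm ({..<m} \<times> {..<n}) (\<lambda>(i, k) (j, l) z. x i j k l * z))\<rparr>"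

definition cb_norm ::
  "('a::ab_group_add) matrix_normed \<Rightarrow> ('b::ab_group_add) matrix_normed \<Rightarrow> ('a \<Rightarrow> 'b) \<Rightarrow> real" where
  "cb_norm V W u =
     (SUP (m, y)\<in>{(m, y). 1 \<le> m \<and> y \<in> matrices m V \<and> os_norm V m y \<le> 1}.
        os_norm W m (amplification m u y))"

text \<open>
  The carrier of the dual is the set of bounded linear functionals, normalised to vanish off the
  carrier of \<open>V\<close> so that equality of functionals is equality of functions.  A matrix \<open>F\<close> of
  functionals is identified with the matrix-valued map sending \<open>y\<close> to the matrix \<open>F i j y\<close>.
\<close>

definition dual_os :: "('a::ab_group_add) matrix_normed \<Rightarrow> ('a \<Rightarrow> complex) matrix_normed" where
  "dual_os V =
     \<lparr>os_carrier = {\<phi>. clinear_on (os_carrier V) (os_smul V) (*) \<phi> \<and>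
                       (\<exists>C. \<forall>x\<in>matrices 1 V. cmod (\<phi> (x 0 0)) \<le> C * os_norm V 1 x) \<and>
                       (\<forall>y. y \<notin> os_carrier V \<longrightarrow> \<phi> y = 0)},
      os_smul = (\<lambda>a \<phi> y. a * \<phi> y),
      os_norm = (\<lambda>n F. cb_norm V (scalar_matrices_os n) (\<lambda>y i j. F i j y))\<rparr>"

definition direct_sum_os ::
  "'a matrix_normed \<Rightarrow> 'b matrix_normed \<Rightarrow> ('a \<times> 'b) matrix_normed" where
  "direct_sum_os V W =
     \<lparr>os_carrier = os_carrier V \<times> os_carrier W,
      os_smul = (\<lambda>a (v, w). (os_smul V a v, os_smul W a w)),
      os_norm = (\<lambda>n x. max (os_norm V n (\<lambda>i j. fst (x i j))) (os_norm W n (\<lambda>i j. snd (x i j))))\<rparr>"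


section \<open>Lipschitz embeddings\<close>

definition lipschitz_map ::
  "'a set \<Rightarrow> ('a \<Rightarrow> 'a \<Rightarrow> real) \<Rightarrow> ('b \<Rightarrow> 'b \<Rightarrow> real) \<Rightarrow> ('a \<Rightarrow> 'b) \<Rightarrow> bool" where
  "lipschitz_map A d e g \<longleftrightarrow> (\<exists>L. \<forall>x\<in>A. \<forall>y\<in>A. e (g x) (g y) \<le> L * d x y)"

definition lipschitz_embedding ::
  "'a set \<Rightarrow> ('a \<Rightarrow> 'a \<Rightarrow> real) \<Rightarrow> 'b set \<Rightarrow> ('b \<Rightarrow> 'b \<Rightarrow> real) \<Rightarrow> ('a \<Rightarrow> 'b) \<Rightarrow> bool" where
  "lipschitz_embedding A d B e g \<longleftrightarrow>
     g ` A \<subseteq> B \<and> inj_on g A \<and> lipschitz_map A d e g \<and> lipschitz_map (g ` A) e d (inv_into A g)"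

definition lipschitz_distortion ::
  "'a set \<Rightarrow> ('a \<Rightarrow> 'a \<Rightarrow> real) \<Rightarrow> ('b \<Rightarrow> 'b \<Rightarrow> real) \<Rightarrow> ('a \<Rightarrow> 'b) \<Rightarrow> real" where
  "lipschitz_distortion A d e g =
     Inf {D. D > 0 \<and> (\<exists>r>0. \<forall>x\<in>A. \<forall>y\<in>A. r * d x y \<le> e (g x) (g y) \<and> e (g x) (g y) \<le> D * r * d x y)}"

definition amplifications_embed ::
  "('a::ab_group_add) matrix_normed \<Rightarrow> ('b::ab_group_add) matrix_normed
    \<Rightarrow> real \<Rightarrow> (nat \<Rightarrow> 'a \<Rightarrow> 'b) \<Rightarrow> bool" where
  "amplifications_embed X Z D f \<longleftrightarrow>
     (\<forall>n\<ge>1. f n ` os_carrier X \<subseteq> os_carrier Z \<and>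
        lipschitz_embedding (matrices n X) (matrix_dist n X) (matrices n Z) (matrix_dist n Z)
          (amplification n (f n)) \<and>
        lipschitz_distortion (matrices n X) (matrix_dist n X) (matrix_dist n Z)
          (amplification n (f n)) \<le> D)"

definition almost_completely_lipschitz_embeds ::
  "('a::ab_group_add) matrix_normed \<Rightarrow> ('b::ab_group_add) matrix_normed \<Rightarrow> bool" where
  "almost_completely_lipschitz_embeds X Z \<longleftrightarrow> (\<exists>D>0. \<exists>f. amplifications_embed X Z D f)"

definition almost_completely_linearly_embeds ::
  "('a::ab_group_add) matrix_normed \<Rightarrow> ('b::ab_group_add) matrix_normed \<Rightarrow> bool" where
  "almost_completely_linearly_embeds X Z \<longleftrightarrow>
     (\<exists>D>0. \<exists>f. amplifications_embed X Z D f \<and>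
        (\<forall>n\<ge>1. clinear_on (os_carrier X) (os_smul X) (os_smul Z) (f n)))"

end

theory Submission
  imports Defs
begin

text \<open>
  The theorem holds because a map between operator spaces whose \<open>N\<close>-th amplification is Lipschitz, for
  large \<open>N\<close>, is nearly additive, and a nearly additive map can be linearized by averaging.

  Let \<open>f\<close> be the map of the given sequence whose \<open>N\<close>-th amplification satisfies
  \<open>r \<parallel>P - Q\<parallel> \<le> \<parallel>f P - f Q\<parallel> \<le> L \<parallel>P - Q\<parallel>\<close>, where \<open>N\<close> is a power of two.  Compare the increments
  \<open>f (x + v) - f x\<close> at two base points by arranging them in the sign pattern of a Hadamard matrix of
  order \<open>N\<close>.  As an operator this pattern has norm \<open>\<surd>N\<close>, whereas the difference of the increments enters
  through a constant matrix, of norm \<open>N\<close>.  Hence the increments at the two base points differ by at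
  most \<open>4 L \<parallel>v\<parallel> / \<surd>N\<close> (\<open>almost_additive\<close>).

  The additive group of \<open>X\<close> is amenable (\<open>invariant_mean_complex\<close>, which rests on the Hahn--Banach
  theorem).  The mean of \<open>f (x + v) - f x\<close> over all \<open>x\<close>, taken at each point of \<open>Y\<close>, is therefore a
  real-linear map \<open>g\<close> into the dual of \<open>Y\<close> with \<open>\<parallel>g v - (f v - f 0)\<parallel> \<le> 4 L \<parallel>v\<parallel> / \<surd>N\<close>
  (\<open>linearization\<close>).  On \<open>n \<times> n\<close> matrices the error is at most \<open>n\<^sup>2\<close> times larger, so for \<open>N\<close> large
  compared with \<open>n\<close> the \<open>n\<close>-th amplification of \<open>g\<close> still has distortion bounded independently of \<open>n\<close>.

  Finally \<open>g\<close> is split into its complex-linear and its antilinear part.  The antilinear part becomes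
  complex-linear with values in the dual of the conjugate of \<open>Y\<close>, and the pair of both parts controls
  \<open>g\<close> up to a factor \<open>2\<close> (\<open>linear_approximant\<close>).
\<close>

section \<open>The Hahn--Banach theorem\<close>

definition sublinear_on :: "(real \<Rightarrow> 'v \<Rightarrow> 'v) \<Rightarrow> ('v::ab_group_add) set \<Rightarrow> ('v \<Rightarrow> real) \<Rightarrow> bool" where
  "sublinear_on smul B q \<longleftrightarrow>
     (\<forall>h\<in>B. \<forall>h'\<in>B. q (h + h') \<le> q h + q h') \<and> (\<forall>c>0. \<forall>h\<in>B. q (smul c h) \<le> c * q h)"

lemma sublinear_on_zero:
  assumes "vector_space smul" "module.subspace smul B" "sublinear_on smul B q"
  shows "q 0 = 0"
proof -
  interpret vector_space smul by fact
  have 0: "0 \<in> B" using assms(2) by (rule subspace_0)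
  then have "q (0 + 0) \<le> q 0 + q 0" "q (smul (1/2) 0) \<le> (1/2) * q 0"
    using assms(3) unfolding sublinear_on_def by (blast, metis half_gt_zero_iff zero_less_one)
  then show ?thesis by simp
qed

lemma sublinear_on_scale:
  assumes "vector_space smul" "module.subspace smul B" "sublinear_on smul B q" "h \<in> B" "0 \<le> c"
  shows "q (smul c h) = c * q h"
proof (cases "c = 0")
  case True
  interpret vector_space smul by fact
  show ?thesis using sublinear_on_zero[OF assms(1-3)] True by simp
next
  case False
  interpret vector_space smul by fact
  have c: "c > 0" using False assms by simp
  have "q (smul c h) \<le> c * q h" using assms c by (simp add: sublinear_on_def)
  moreover have "q (smul (1/c) (smul c h)) \<le> (1/c) * q (smul c h)"
    using assms(3) c subspace_scale[OF assms(2,4)] unfolding sublinear_on_def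
    by (meson divide_pos_pos zero_less_one)
  then have "c * q h \<le> q (smul c h)" using c by (simp add: field_simps)
  ultimately show ?thesis by simp
qed

lemma sublinear_on_neg:
  assumes "vector_space smul" "module.subspace smul B" "sublinear_on smul B q" "h \<in> B"
  shows "- q (- h) \<le> q h"
proof -
  interpret vector_space smul by fact
  have "- h \<in> B" using assms(2,4) subspace_neg by blast
  then have "q (h + - h) \<le> q h + q (- h)" using assms unfolding sublinear_on_def by blast
  then show ?thesis using sublinear_on_zero[OF assms(1-3)] by simp
qed

text \<open>
  Lowering a sublinear functional \<open>q\<close> along the direction \<open>u\<close> as far as sublinearity permits.  The
  last bound forces \<open>q\<close> to be additive along \<open>u\<close> as soon as the lowered functional is \<open>q\<close> itself.
\<close>

lemma sublinear_on_lower: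
  fixes smul :: "real \<Rightarrow> 'v::ab_group_add \<Rightarrow> 'v"
  assumes vs: "vector_space smul" and B: "module.subspace smul B"
    and q: "sublinear_on smul B q" and u: "u \<in> B"
  obtains q' where "sublinear_on smul B q'" "\<And>h. h \<in> B \<Longrightarrow> q' h \<le> q h"
    "\<And>h. h \<in> B \<Longrightarrow> q' h \<le> q (h + u) - q u"
proof -
  interpret vector_space smul by fact
  define T where "T h = {q (h + smul t u) - t * q u | t. t \<ge> 0}" for h
  define q' where "q' h = Inf (T h)" for h
  have TI: "q (h + smul t u) - t * q u \<in> T h" if "t \<ge> 0" for t h
    using that T_def by blast
  have in_B: "h + smul t u \<in> B" if "h \<in> B" for h t
    using that u B subspace_add subspace_scale by blast
  have below: "- q (- h) \<le> s" if h: "h \<in> B" and s: "s \<in> T h" for h s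
  proof -
    obtain t where t: "t \<ge> 0" "s = q (h + smul t u) - t * q u" using s T_def by auto
    have "q ((h + smul t u) + (- h)) \<le> q (h + smul t u) + q (- h)"
      using q in_B[OF h] subspace_neg[OF B h] unfolding sublinear_on_def by blast
    then show ?thesis using sublinear_on_scale[OF vs B q u t(1)] t by simp
  qed
  have le: "q' h \<le> s" if "h \<in> B" "s \<in> T h" for h s
    unfolding q'_def using that below by (intro cInf_lower bdd_belowI) auto
  have ge: "c \<le> q' h" if "\<And>s. s \<in> T h \<Longrightarrow> c \<le> s" for c h
    unfolding q'_def using TI[of 0 h] that by (intro cInf_greatest) auto
  have "q' (h + h') \<le> q' h + q' h'" if h: "h \<in> B" "h' \<in> B" for h h'
  proof -
    have "q' (h + h') \<le> s + s'" if ss: "s \<in> T h" "s' \<in> T h'" for s s'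
    proof -
      obtain t t' where t: "t \<ge> 0" "s = q (h + smul t u) - t * q u"
        "t' \<ge> 0" "s' = q (h' + smul t' u) - t' * q u" using ss T_def by auto
      have "q' (h + h') \<le> q (h + h' + smul (t + t') u) - (t + t') * q u"
        by (rule le) (use t TI subspace_add B h in auto)
      also have "h + h' + smul (t + t') u = (h + smul t u) + (h' + smul t' u)"
        by (simp add: scale_left_distrib algebra_simps)
      also have "q \<dots> \<le> q (h + smul t u) + q (h' + smul t' u)"
        using q in_B h by (simp add: sublinear_on_def)
      finally show ?thesis using t by (simp add: algebra_simps)
    qed
    then have "q' (h + h') - s' \<le> s" if "s \<in> T h" "s' \<in> T h'" for s s'
      using that by fastforce
    then have "q' (h + h') - s' \<le> q' h" if "s' \<in> T h'" for s'
      using that by (intro ge) auto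
    then have "q' (h + h') - q' h \<le> s'" if "s' \<in> T h'" for s' using that by fastforce
    then have "q' (h + h') - q' h \<le> q' h'" by (intro ge) auto
    then show ?thesis by simp
  qed
  moreover have "q' (smul c h) \<le> c * q' h" if c: "c > 0" and h: "h \<in> B" for c h
  proof -
    have "q' (smul c h) / c \<le> s" if s: "s \<in> T h" for s
    proof -
      obtain t where t: "t \<ge> 0" "s = q (h + smul t u) - t * q u" using s T_def by auto
      have "q' (smul c h) \<le> q (smul c h + smul (c * t) u) - (c * t) * q u"
        by (rule le) (use t TI c subspace_scale B h in auto)
      also have "smul c h + smul (c * t) u = smul c (h + smul t u)"
        by (simp add: scale_right_distrib)
      also have "q \<dots> = c * q (h + smul t u)"
        using sublinear_on_scale[OF vs B q in_B[OF h]] c by simp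
      finally have "q' (smul c h) \<le> c * s" using t by (simp add: right_diff_distrib)
      then show ?thesis using c by (simp add: field_simps)
    qed
    then have "q' (smul c h) / c \<le> q' h" by (rule ge)
    then show ?thesis using c by (simp add: field_simps)
  qed
  ultimately have "sublinear_on smul B q'" by (simp add: sublinear_on_def)
  moreover have "q' h \<le> q h" if "h \<in> B" for h using le[OF that TI[of 0 h]] by simp
  moreover have "q' h \<le> q (h + u) - q u" if "h \<in> B" for h using le[OF that TI[of 1 h]] by simp
  ultimately show ?thesis using that by blast
qed

text \<open>
  The Hahn--Banach theorem in its sublinear form.  By Zorn's lemma there is a minimal sublinear
  functional below \<open>p\<close>; it cannot be lowered along any direction, so it is additive.
\<close>

theorem hahn_banach_sublinear:
  fixes smul :: "real \<Rightarrow> 'v::ab_group_add \<Rightarrow> 'v"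
  assumes vs: "vector_space smul" and B: "module.subspace smul B"
    and p: "sublinear_on smul B p"
  obtains m where "\<And>h h'. h \<in> B \<Longrightarrow> h' \<in> B \<Longrightarrow> m (h + h') = m h + m h'"
    "\<And>c h. h \<in> B \<Longrightarrow> m (smul c h) = c * m h"
    "\<And>h. h \<in> B \<Longrightarrow> m h \<le> p h"
proof -
  interpret vector_space smul by fact
  \<comment> \<open>Fixing the value \<open>0\<close> outside \<open>B\<close> makes the pointwise order on all functions the order on \<open>B\<close>.\<close>
  define A where "A = {q. sublinear_on smul B q \<and> (\<forall>h\<in>B. q h \<le> p h) \<and> (\<forall>h. h \<notin> B \<longrightarrow> q h = 0)}"
  define R where "R = relation_of (\<lambda>q q'. q' \<le> q) A"
  have "partial_order_on A R"
    unfolding R_def by (rule partial_order_on_relation_ofI) auto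
  moreover have "\<exists>q\<in>A. \<forall>q'\<in>C. q \<le> q'" if C: "C \<in> Chains R" for C
  proof (cases "C = {}")
    case True
    have "(\<lambda>h. if h \<in> B then p h else 0) \<in> A"
      using p subspace_add[OF B] subspace_scale[OF B] by (auto simp: A_def sublinear_on_def)
    then show ?thesis using True by blast
  next
    case False
    have CA: "C \<subseteq> A" and total: "\<And>q q'. q \<in> C \<Longrightarrow> q' \<in> C \<Longrightarrow> q \<le> q' \<or> q' \<le> q"
      using C by (auto simp: Chains_def R_def relation_of_def)
    define r where "r h = (INF q\<in>C. q h)" for h
    have low: "- p (- h) \<le> q h" if "q \<in> C" "h \<in> B" for q h
    proof -
      have "q \<in> A" using CA that by blast
      then have "- q (- h) \<le> q h" "q (- h) \<le> p (- h)"
        using sublinear_on_neg[OF vs B _ that(2)] subspace_neg[OF B that(2)] by (auto simp: A_def)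
      then show ?thesis by simp
    qed
    have zero: "q h = 0" if "q \<in> C" "h \<notin> B" for q h using that CA by (auto simp: A_def)
    have bdd: "bdd_below ((\<lambda>q. q h) ` C)" for h
      by (cases "h \<in> B") (auto intro!: bdd_belowI2 low simp: zero)
    have le: "r h \<le> q h" if "q \<in> C" for q h
      unfolding r_def using bdd that by (rule cINF_lower)
    have ge: "c \<le> r h" if "\<And>q. q \<in> C \<Longrightarrow> c \<le> q h" for c h
      unfolding r_def using False that by (rule cINF_greatest)
    have "r (h + h') \<le> r h + r h'" if h: "h \<in> B" "h' \<in> B" for h h'
    proof -
      have *: "r (h + h') \<le> q h + q' h'" if qs: "q \<in> C" "q' \<in> C" for q q'
      proof -
        have "\<exists>s\<in>C. s \<le> q \<and> s \<le> q'" using total[OF qs] qs by blast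
        then obtain s where s: "s \<in> C" "s \<le> q" "s \<le> q'" by blast
        have "r (h + h') \<le> s (h + h')" by (rule le[OF s(1)])
        also have "\<dots> \<le> s h + s h'" using s(1) CA h by (auto simp: A_def sublinear_on_def)
        also have "\<dots> \<le> q h + q' h'" using s by (simp add: le_fun_def add_mono)
        finally show ?thesis .
      qed
      have "r (h + h') - q' h' \<le> r h" if "q' \<in> C" for q'
        by (rule ge) (use *[OF _ that] in \<open>simp add: algebra_simps\<close>)
      then have "r (h + h') - r h \<le> r h'"
        by (intro ge) (simp add: algebra_simps)
      then show ?thesis by simp
    qed
    moreover have "r (smul c h) \<le> c * r h" if c: "c > 0" and h: "h \<in> B" for c h
    proof -
      have "r (smul c h) / c \<le> q h" if "q \<in> C" for q
      proof -
        have "r (smul c h) \<le> q (smul c h)" by (rule le[OF that])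
        also have "\<dots> \<le> c * q h" using that CA h c by (auto simp: A_def sublinear_on_def)
        finally show ?thesis using c by (simp add: field_simps)
      qed
      then have "r (smul c h) / c \<le> r h" by (rule ge)
      then show ?thesis using c by (simp add: field_simps)
    qed
    moreover have "r h \<le> p h" if "h \<in> B" for h
    proof -
      obtain q where "q \<in> C" using False by blast
      moreover from this have "q h \<le> p h" using CA that by (auto simp: A_def)
      ultimately show ?thesis using le order_trans by blast
    qed
    moreover have "r h = 0" if "h \<notin> B" for h
    proof -
      have "(\<lambda>q. q h) ` C = {0}" using zero[OF _ that] False by (force simp: image_iff)
      then show ?thesis by (simp add: r_def)
    qed
    ultimately have "r \<in> A" by (simp add: A_def sublinear_on_def)
    then show ?thesis using le by (auto simp: le_fun_def)
  qed
  ultimately obtain m where m: "m \<in> A" and minimal: "\<And>q. q \<in> A \<Longrightarrow> q \<le> m \<Longrightarrow> q = m"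
    using predicate_Zorn[of A "\<lambda>q q'. q' \<le> q"] unfolding R_def by metis
  have sub: "sublinear_on smul B m" using m by (simp add: A_def)
  have add: "m (h + u) = m h + m u" if h: "h \<in> B" and u: "u \<in> B" for h u
  proof -
    obtain q where q: "sublinear_on smul B q" "\<And>h. h \<in> B \<Longrightarrow> q h \<le> m h"
      "\<And>h. h \<in> B \<Longrightarrow> q h \<le> m (h + u) - m u"
      using sublinear_on_lower[OF vs B sub u] by blast
    define q0 where "q0 h = (if h \<in> B then q h else 0)" for h
    have "q0 \<in> A"
      using q m subspace_add[OF B] subspace_scale[OF B]
      by (fastforce simp: A_def sublinear_on_def q0_def)
    moreover have "q0 \<le> m" using q m by (auto simp: q0_def le_fun_def A_def)
    ultimately have "q0 = m" by (rule minimal)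
    then have "m h = q0 h" by simp
    then have "m h = q h" using h by (simp add: q0_def)
    then have "m h \<le> m (h + u) - m u" using q(3)[OF h] by simp
    moreover have "m (h + u) \<le> m h + m u" using sub h u by (simp add: sublinear_on_def)
    ultimately show ?thesis by simp
  qed
  have zero: "m 0 = 0" by (rule sublinear_on_zero[OF vs B sub])
  have "m (smul c h) = c * m h" if h: "h \<in> B" for c h
  proof (cases "c \<ge> 0")
    case True
    then show ?thesis by (rule sublinear_on_scale[OF vs B sub h])
  next
    case False
    then have "m (smul (- c) h) = (- c) * m h" by (intro sublinear_on_scale[OF vs B sub h]) simp
    moreover have "m (smul c h + smul (- c) h) = m (smul c h) + m (smul (- c) h)"
      by (rule add) (rule subspace_scale[OF B h])+
    moreover have "smul c h + smul (- c) h = 0" by simp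
    ultimately show ?thesis using zero by simp
  qed
  moreover have "m h \<le> p h" if "h \<in> B" for h using m that by (simp add: A_def)
  ultimately show ?thesis using add that by blast
qed

section \<open>Invariant means on abelian groups\<close>

definition translation_average :: "('a::ab_group_add \<Rightarrow> real) \<Rightarrow> 'a list \<Rightarrow> 'a \<Rightarrow> real" where
  "translation_average h ts x = (\<Sum>t\<leftarrow>ts. h (x + t)) / length ts"

text \<open>
  Abelian groups are amenable.  The sublinear functional \<open>p h\<close> is the infimum, over all finite
  lists of translations, of the supremum of the average of \<open>h\<close> over the list; any linear functional
  below it is an invariant mean.  It is subadditive because averaging \<open>h + h'\<close> over all sums of one
  translation from each of two lists is, by commutativity, an average of averages over either list.
  It is nonpositive on \<open>h (\<cdot> + t) - h\<close> and on its negative because averaging over \<open>0, t, \<dots>, (k - 1) t\<close> telescopes.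
\<close>

theorem invariant_mean_real:
  fixes S :: "'a::ab_group_add set"
  assumes zero: "0 \<in> S" and add: "\<And>x y. x \<in> S \<Longrightarrow> y \<in> S \<Longrightarrow> x + y \<in> S"
  obtains m :: "('a \<Rightarrow> real) \<Rightarrow> real" where
    "\<And>h h' C C'. (\<And>x. x \<in> S \<Longrightarrow> \<bar>h x\<bar> \<le> C) \<Longrightarrow> (\<And>x. x \<in> S \<Longrightarrow> \<bar>h' x\<bar> \<le> C') \<Longrightarrow>
       m (\<lambda>x. h x + h' x) = m h + m h'"
    "\<And>h c C. (\<And>x. x \<in> S \<Longrightarrow> \<bar>h x\<bar> \<le> C) \<Longrightarrow> m (\<lambda>x. c * h x) = c * m h"
    "\<And>h C C'. (\<And>x. x \<in> S \<Longrightarrow> \<bar>h x\<bar> \<le> C) \<Longrightarrow> (\<And>x. x \<in> S \<Longrightarrow> h x \<le> C') \<Longrightarrow> m h \<le> C'"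
    "\<And>h t C. (\<And>x. x \<in> S \<Longrightarrow> \<bar>h x\<bar> \<le> C) \<Longrightarrow> t \<in> S \<Longrightarrow> m (\<lambda>x. h (x + t)) = m h"
proof -
  define B :: "('a \<Rightarrow> real) set" where "B = {h. \<exists>C. \<forall>x\<in>S. \<bar>h x\<bar> \<le> C}"
  define smul :: "real \<Rightarrow> ('a \<Rightarrow> real) \<Rightarrow> 'a \<Rightarrow> real" where "smul c h = (\<lambda>x. c * h x)" for c h
  interpret vector_space smul
    by unfold_locales (simp_all add: smul_def fun_eq_iff algebra_simps)
  have B: "subspace B"
  proof (rule subspaceI)
    show "0 \<in> B" by (auto simp: B_def)
    show "h + h' \<in> B" if hh: "h \<in> B" "h' \<in> B" for h h'
    proof -
      obtain C C' where "\<forall>x\<in>S. \<bar>h x\<bar> \<le> C" "\<forall>x\<in>S. \<bar>h' x\<bar> \<le> C'" using hh B_def by auto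
      then have "\<forall>x\<in>S. \<bar>(h + h') x\<bar> \<le> C + C'" by fastforce
      then show ?thesis using B_def by blast
    qed
    show "smul c h \<in> B" if h: "h \<in> B" for c h
    proof -
      obtain C where "\<forall>x\<in>S. \<bar>h x\<bar> \<le> C" using h B_def by auto
      then have "\<forall>x\<in>S. \<bar>smul c h x\<bar> \<le> \<bar>c\<bar> * C" by (simp add: smul_def abs_mult mult_left_mono)
      then show ?thesis using B_def by blast
    qed
  qed
  define T where "T h = {C. \<exists>ts. ts \<noteq> [] \<and> set ts \<subseteq> S \<and> (\<forall>x\<in>S. translation_average h ts x \<le> C)}" for h
  define p where "p h = Inf (T h)" for h
  have avg_ge: "- C \<le> translation_average h ts x"
    if C: "\<forall>x\<in>S. \<bar>h x\<bar> \<le> C" and ts: "ts \<noteq> []" "set ts \<subseteq> S" and x: "x \<in> S" for h ts C x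
  proof -
    have "(\<Sum>t\<leftarrow>ts. - C) \<le> (\<Sum>t\<leftarrow>ts. h (x + t))"
    proof (rule sum_list_mono)
      fix t assume "t \<in> set ts"
      then have "\<bar>h (x + t)\<bar> \<le> C" using C ts x add by blast
      then show "- C \<le> h (x + t)" by linarith
    qed
    then show ?thesis using ts(1) by (simp add: translation_average_def sum_list_triv field_simps)
  qed
  have bdd: "bdd_below (T h)" if h: "h \<in> B" for h
  proof -
    obtain C where C: "\<forall>x\<in>S. \<bar>h x\<bar> \<le> C" using h B_def by auto
    show ?thesis
    proof (rule bdd_belowI[of _ "- C"])
      fix c assume "c \<in> T h"
      then obtain ts where ts: "ts \<noteq> []" "set ts \<subseteq> S" "\<forall>x\<in>S. translation_average h ts x \<le> c"
        by (auto simp: T_def)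
      have "- C \<le> translation_average h ts 0" by (rule avg_ge[OF C ts(1,2) zero])
      then show "- C \<le> c" using ts(3) zero by force
    qed
  qed
  have TI: "C \<in> T h" if "\<And>x. x \<in> S \<Longrightarrow> h x \<le> C" for h C
    unfolding T_def
    by (intro CollectI exI[of _ "[0]"]) (use that zero in \<open>simp add: translation_average_def\<close>)
  have ne: "T h \<noteq> {}" if h: "h \<in> B" for h
  proof -
    obtain C where C: "\<forall>x\<in>S. \<bar>h x\<bar> \<le> C" using h B_def by auto
    then have "C \<in> T h" by (intro TI) (auto simp: abs_le_iff)
    then show ?thesis by blast
  qed
  have le: "p h \<le> C" if "h \<in> B" "C \<in> T h" for h C
    unfolding p_def by (rule cInf_lower[OF that(2) bdd[OF that(1)]])
  have ge: "c \<le> p h" if "h \<in> B" "\<And>C. C \<in> T h \<Longrightarrow> c \<le> C" for c h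
    unfolding p_def using ne[OF that(1)] that(2) by (rule cInf_greatest)
  have "sublinear_on smul B p"
    unfolding sublinear_on_def
  proof (intro conjI ballI allI impI)
    fix h h' assume hh: "h \<in> B" "h' \<in> B"
    have *: "p (h + h') \<le> C + C'" if CC: "C \<in> T h" "C' \<in> T h'" for C C'
    proof -
      obtain ts where ts: "ts \<noteq> []" "set ts \<subseteq> S" "\<forall>x\<in>S. translation_average h ts x \<le> C"
        using CC T_def by auto
      obtain us where us: "us \<noteq> []" "set us \<subseteq> S" "\<forall>x\<in>S. translation_average h' us x \<le> C'"
        using CC T_def by auto
      define vs where "vs = concat (map (\<lambda>t. map (\<lambda>u. t + u) us) ts)"
      have len: "length vs = length ts * length us"
        by (simp add: vs_def length_concat comp_def sum_list_triv)
      have "translation_average (h + h') vs x \<le> C + C'" if x: "x \<in> S" for x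
      proof -
        have sum_vs: "(\<Sum>v\<leftarrow>vs. g (x + v)) = (\<Sum>t\<leftarrow>ts. \<Sum>u\<leftarrow>us. g (x + t + u))"
          for g :: "'a \<Rightarrow> real"
          unfolding vs_def by (induction ts) (simp_all add: comp_def add.assoc)
        have swap: "(\<Sum>t\<leftarrow>ts. \<Sum>u\<leftarrow>us. g (x + t + u)) = (\<Sum>u\<leftarrow>us. \<Sum>t\<leftarrow>ts. g (x + u + t))"
          for g :: "'a \<Rightarrow> real"
        proof (induction ts)
          case (Cons t ts)
          then show ?case by (simp add: sum_list_addf ac_simps)
        qed simp
        have "(\<Sum>u\<leftarrow>us. \<Sum>t\<leftarrow>ts. h (x + u + t)) \<le> (\<Sum>u\<leftarrow>us. C * length ts)"
        proof (rule sum_list_mono)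
          fix u assume "u \<in> set us"
          then have "translation_average h ts (x + u) \<le> C" using ts us x add by blast
          then show "(\<Sum>t\<leftarrow>ts. h (x + u + t)) \<le> C * length ts"
            using ts(1) by (simp add: translation_average_def field_simps)
        qed
        moreover have "(\<Sum>t\<leftarrow>ts. \<Sum>u\<leftarrow>us. h' (x + t + u)) \<le> (\<Sum>t\<leftarrow>ts. C' * length us)"
        proof (rule sum_list_mono)
          fix t assume "t \<in> set ts"
          then have "translation_average h' us (x + t) \<le> C'" using ts us x add by blast
          then show "(\<Sum>u\<leftarrow>us. h' (x + t + u)) \<le> C' * length us"
            using us(1) by (simp add: translation_average_def field_simps)
        qed
        ultimately have "(\<Sum>v\<leftarrow>vs. (h + h') (x + v)) \<le> (C + C') * length vs"
          using sum_vs[of h] sum_vs[of h'] swap[of h]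
          by (simp add: sum_list_addf sum_list_triv len algebra_simps)
        moreover have "length vs > 0" using len ts(1) us(1) by simp
        ultimately show ?thesis by (simp add: translation_average_def field_simps)
      qed
      moreover have "vs \<noteq> []" using len ts(1) us(1) by (metis length_0_conv mult_eq_0_iff)
      moreover have "set vs \<subseteq> S" using ts(2) us(2) add by (auto simp: vs_def subset_iff)
      ultimately have "C + C' \<in> T (h + h')" unfolding T_def by blast
      then show ?thesis using le subspace_add[OF B] hh by blast
    qed
    have "p (h + h') - C' \<le> p h" if "C' \<in> T h'" for C'
      by (rule ge[OF hh(1)]) (use *[OF _ that] in \<open>simp add: algebra_simps\<close>)
    then have "p (h + h') - p h \<le> p h'" by (intro ge[OF hh(2)]) (simp add: algebra_simps)
    then show "p (h + h') \<le> p h + p h'" by simp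
  next
    fix c :: real and h assume c: "c > 0" and h: "h \<in> B"
    have "p (smul c h) / c \<le> C" if C: "C \<in> T h" for C
    proof -
      have "translation_average (smul c h) ts x = c * translation_average h ts x" for ts x
        by (simp add: translation_average_def smul_def sum_list_const_mult)
      then have "c * C \<in> T (smul c h)" using C c by (auto simp: T_def)
      then have "p (smul c h) \<le> c * C" using le subspace_scale[OF B h] by blast
      then show ?thesis using c by (simp add: field_simps)
    qed
    then have "p (smul c h) / c \<le> p h" by (rule ge[OF h])
    then show "p (smul c h) \<le> c * p h" using c by (simp add: field_simps)
  qed
  then obtain m where m: "\<And>h h'. h \<in> B \<Longrightarrow> h' \<in> B \<Longrightarrow> m (h + h') = m h + m h'"
    "\<And>c h. h \<in> B \<Longrightarrow> m (smul c h) = c * m h" "\<And>h. h \<in> B \<Longrightarrow> m h \<le> p h"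
    using hahn_banach_sublinear[OF vector_space_axioms B] by blast
  have BI: "h \<in> B" if "\<And>x. x \<in> S \<Longrightarrow> \<bar>h x\<bar> \<le> C" for h C
    using that B_def by blast
  have diff: "m (\<lambda>x. h x - h' x) = m h - m h'" if hh: "h \<in> B" "h' \<in> B" for h h'
  proof -
    have "m (h + smul (-1) h') = m h + m (smul (-1) h')"
      by (rule m(1)[OF hh(1) subspace_scale[OF B hh(2)]])
    then have "m (h + smul (-1) h') = m h - m h'" using m(2)[OF hh(2), of "-1"] by linarith
    moreover have "h + smul (-1) h' = (\<lambda>x. h x - h' x)" by (simp add: smul_def fun_eq_iff)
    ultimately show ?thesis by simp
  qed
  have translate_le: "m (\<lambda>x. h (x + t)) \<le> m h" and translate_ge: "m h \<le> m (\<lambda>x. h (x + t))"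
    if C: "\<And>x. x \<in> S \<Longrightarrow> \<bar>h x\<bar> \<le> C" and t: "t \<in> S" for h C t
  proof -
    \<comment> \<open>The multiple \<open>i t\<close>.\<close>
    define it where "it i = ((\<lambda>s. s + t) ^^ i) 0" for i
    have it_S: "it i \<in> S" for i by (induction i) (simp_all add: it_def zero add t)
    have ht: "(\<lambda>x. h (x + t)) \<in> B" by (rule BI[of _ C]) (simp add: C add t)
    have h: "h \<in> B" using C by (rule BI)
    define d where "d = (\<lambda>x. h (x + t) - h x)"
    have "(\<lambda>x. h (x + t)) + smul (-1) h \<in> B" using ht h B subspace_add subspace_scale by blast
    then have d: "d \<in> B" by (simp add: d_def smul_def plus_fun_def)
    have telescope: "(\<Sum>s\<leftarrow>map it [0..<k]. d (x + s)) = h (x + it k) - h x" for k x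
      by (induction k) (simp_all add: d_def it_def add.assoc)
    have avg: "\<bar>translation_average d (map it [0..<Suc k]) x\<bar> \<le> 2 * C / Suc k" if "x \<in> S" for x k
    proof -
      have "\<bar>h (x + it (Suc k)) - h x\<bar> \<le> 2 * C"
        using C[OF add[OF that it_S[of "Suc k"]]] C[OF that] by linarith
      then show ?thesis
        unfolding translation_average_def telescope by (simp add: divide_right_mono)
    qed
    have small: "m d \<le> 2 * C / Suc k" "m (smul (-1) d) \<le> 2 * C / Suc k" for k
    proof -
      have "2 * C / Suc k \<in> T d"
        unfolding T_def using avg it_S
        by (intro CollectI exI[of _ "map it [0..<Suc k]"]) (auto simp del: upt_Suc simp: abs_le_iff)
      moreover have "translation_average (smul (-1) d) ts x = - translation_average d ts x" for ts x
      proof -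
        have "(\<Sum>t\<leftarrow>ts. - d (x + t)) = - (\<Sum>t\<leftarrow>ts. d (x + t))" by (induction ts) simp_all
        then show ?thesis by (simp add: translation_average_def smul_def)
      qed
      then have "2 * C / Suc k \<in> T (smul (-1) d)"
        unfolding T_def using avg it_S
        by (intro CollectI exI[of _ "map it [0..<Suc k]"]) (auto simp del: upt_Suc simp: abs_le_iff)
      ultimately show "m d \<le> 2 * C / Suc k" "m (smul (-1) d) \<le> 2 * C / Suc k"
        using m(3)[OF d] m(3)[OF subspace_scale[OF B d, of "-1"]] le d subspace_scale[OF B d]
        by (meson order_trans)+
    qed
    have "(\<lambda>k. 2 * C / Suc k) \<longlonglongrightarrow> 0"
      using LIMSEQ_Suc[OF lim_const_over_n[of "2 * C"]] by simp
    then have "m d \<le> 0" "m (smul (-1) d) \<le> 0"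
      using small by (auto intro: LIMSEQ_le_const)
    then show "m (\<lambda>x. h (x + t)) \<le> m h" "m h \<le> m (\<lambda>x. h (x + t))"
      using diff[OF ht h] m(2)[OF d, of "-1"] by (simp_all add: d_def)
  qed
  show ?thesis
  proof (rule that[of m])
    show "m (\<lambda>x. h x + h' x) = m h + m h'"
      if "\<And>x. x \<in> S \<Longrightarrow> \<bar>h x\<bar> \<le> C" "\<And>x. x \<in> S \<Longrightarrow> \<bar>h' x\<bar> \<le> C'" for h h' C C'
    proof -
      have "h \<in> B" "h' \<in> B" using that BI by blast+
      then show ?thesis using m(1) by (simp add: plus_fun_def)
    qed
    show "m (\<lambda>x. c * h x) = c * m h" if "\<And>x. x \<in> S \<Longrightarrow> \<bar>h x\<bar> \<le> C" for h c C
    proof -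
      have "h \<in> B" using that by (rule BI)
      then show ?thesis using m(2) by (simp add: smul_def)
    qed
    show "m h \<le> C'" if "\<And>x. x \<in> S \<Longrightarrow> \<bar>h x\<bar> \<le> C" "\<And>x. x \<in> S \<Longrightarrow> h x \<le> C'" for h C C'
    proof -
      have h: "h \<in> B" using that(1) by (rule BI)
      have "C' \<in> T h" using that(2) by (rule TI)
      then show ?thesis using m(3)[OF h] le[OF h] by fastforce
    qed
    show "m (\<lambda>x. h (x + t)) = m h" if "\<And>x. x \<in> S \<Longrightarrow> \<bar>h x\<bar> \<le> C" "t \<in> S" for h t C
      using that by (intro antisym translate_le[of h C] translate_ge[of h C])
  qed
qed


theorem invariant_mean_complex:
  fixes S :: "'a::ab_group_add set"
  assumes zero: "0 \<in> S" and add: "\<And>x y. x \<in> S \<Longrightarrow> y \<in> S \<Longrightarrow> x + y \<in> S"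
  obtains m :: "('a \<Rightarrow> complex) \<Rightarrow> complex" where
    "\<And>h h' C C'. (\<And>x. x \<in> S \<Longrightarrow> cmod (h x) \<le> C) \<Longrightarrow> (\<And>x. x \<in> S \<Longrightarrow> cmod (h' x) \<le> C') \<Longrightarrow>
       m (\<lambda>x. h x + h' x) = m h + m h'"
    "\<And>h c C. (\<And>x. x \<in> S \<Longrightarrow> cmod (h x) \<le> C) \<Longrightarrow> m (\<lambda>x. c * h x) = c * m h"
    "\<And>h C. (\<And>x. x \<in> S \<Longrightarrow> cmod (h x) \<le> C) \<Longrightarrow> cmod (m h) \<le> C"
    "\<And>h t C. (\<And>x. x \<in> S \<Longrightarrow> cmod (h x) \<le> C) \<Longrightarrow> t \<in> S \<Longrightarrow> m (\<lambda>x. h (x + t)) = m h"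
    "\<And>c. m (\<lambda>x. c) = c"
proof -
  obtain m :: "('a \<Rightarrow> real) \<Rightarrow> real" where
    m_add: "\<And>h h' C C'. (\<And>x. x \<in> S \<Longrightarrow> \<bar>h x\<bar> \<le> C) \<Longrightarrow> (\<And>x. x \<in> S \<Longrightarrow> \<bar>h' x\<bar> \<le> C') \<Longrightarrow>
       m (\<lambda>x. h x + h' x) = m h + m h'"
    and m_scale: "\<And>h c C. (\<And>x. x \<in> S \<Longrightarrow> \<bar>h x\<bar> \<le> C) \<Longrightarrow> m (\<lambda>x. c * h x) = c * m h"
    and m_le: "\<And>h C C'. (\<And>x. x \<in> S \<Longrightarrow> \<bar>h x\<bar> \<le> C) \<Longrightarrow> (\<And>x. x \<in> S \<Longrightarrow> h x \<le> C') \<Longrightarrow> m h \<le> C'"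
    and m_shift: "\<And>h t C. (\<And>x. x \<in> S \<Longrightarrow> \<bar>h x\<bar> \<le> C) \<Longrightarrow> t \<in> S \<Longrightarrow> m (\<lambda>x. h (x + t)) = m h"
    by (rule invariant_mean_real[OF zero add]) blast+
  define M where "M h = Complex (m (\<lambda>x. Re (h x))) (m (\<lambda>x. Im (h x)))" for h
  have Re_le: "\<bar>Re (h x)\<bar> \<le> C" and Im_le: "\<bar>Im (h x)\<bar> \<le> C"
    if "\<And>x. x \<in> S \<Longrightarrow> cmod (h x) \<le> C" "x \<in> S" for h C x
    using abs_Re_le_cmod[of "h x"] abs_Im_le_cmod[of "h x"] that(1)[OF that(2)] by linarith+
  have const: "m (\<lambda>x. c) = c" for c
  proof -
    have "m (\<lambda>x. c) \<le> c" "m (\<lambda>x. - c) \<le> - c"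
      by (rule m_le[of _ "\<bar>c\<bar>"]; simp)+
    moreover have "m (\<lambda>x. (-1) * c) = (-1) * m (\<lambda>x. c)"
      by (rule m_scale[of _ "\<bar>c\<bar>"]) simp
    ultimately show ?thesis by simp
  qed
  have scale: "M (\<lambda>x. c * h x) = c * M h" if C: "\<And>x. x \<in> S \<Longrightarrow> cmod (h x) \<le> C" for h c C
  proof -
    have part: "m (\<lambda>x. a * Re (h x) + b * Im (h x)) = a * m (\<lambda>x. Re (h x)) + b * m (\<lambda>x. Im (h x))"
      for a b
    proof -
      have "m (\<lambda>x. a * Re (h x) + b * Im (h x)) = m (\<lambda>x. a * Re (h x)) + m (\<lambda>x. b * Im (h x))"
        by (rule m_add[of _ "\<bar>a\<bar> * C" _ "\<bar>b\<bar> * C"])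
          (auto simp: abs_mult intro!: mult_left_mono Re_le[OF C] Im_le[OF C])
      moreover have "m (\<lambda>x. a * Re (h x)) = a * m (\<lambda>x. Re (h x))"
        by (rule m_scale[of _ C]) (rule Re_le[OF C])
      moreover have "m (\<lambda>x. b * Im (h x)) = b * m (\<lambda>x. Im (h x))"
        by (rule m_scale[of _ C]) (rule Im_le[OF C])
      ultimately show ?thesis by simp
    qed
    show ?thesis
      using part[of "Re c" "- Im c"] part[of "Im c" "Re c"]
      by (simp add: M_def complex_eq_iff algebra_simps)
  qed
  have "cmod (M h) \<le> C" if C: "\<And>x. x \<in> S \<Longrightarrow> cmod (h x) \<le> C" for h C
  proof (cases "M h = 0")
    case True
    then show ?thesis using C[OF zero] by (smt (verit) norm_ge_zero norm_zero)
  next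
    case False
    \<comment> \<open>Rotate so that the mean becomes a nonnegative real; then only the real part matters.\<close>
    define w where "w = cnj (M h) / cmod (M h)"
    have w: "cmod w = 1" using False by (simp add: w_def norm_divide)
    have "w * M h = cmod (M h)"
      using False by (simp add: w_def complex_norm_square[symmetric] power2_eq_square mult.commute)
    then have "M (\<lambda>x. w * h x) = cmod (M h)" using scale[OF C] by simp
    then have "m (\<lambda>x. Re (w * h x)) = cmod (M h)" by (simp add: M_def complex_eq_iff)
    moreover have "cmod (w * h x) \<le> C" if "x \<in> S" for x
      using C[OF that] w by (simp add: norm_mult)
    then have "m (\<lambda>x. Re (w * h x)) \<le> C"
      using Re_le[of "\<lambda>x. w * h x" C] by (intro m_le[of _ C]) (auto simp: abs_le_iff)
    ultimately show ?thesis by simp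
  qed
  moreover have "M (\<lambda>x. h x + h' x) = M h + M h'"
    if "\<And>x. x \<in> S \<Longrightarrow> cmod (h x) \<le> C" "\<And>x. x \<in> S \<Longrightarrow> cmod (h' x) \<le> C'" for h h' C C'
  proof -
    have "m (\<lambda>x. Re (h x) + Re (h' x)) = m (\<lambda>x. Re (h x)) + m (\<lambda>x. Re (h' x))"
      by (rule m_add[of _ C _ C']) (auto intro: Re_le that)
    moreover have "m (\<lambda>x. Im (h x) + Im (h' x)) = m (\<lambda>x. Im (h x)) + m (\<lambda>x. Im (h' x))"
      by (rule m_add[of _ C _ C']) (auto intro: Im_le that)
    ultimately show ?thesis by (simp add: M_def complex_eq_iff)
  qed
  moreover have "M (\<lambda>x. h (x + t)) = M h"
    if "\<And>x. x \<in> S \<Longrightarrow> cmod (h x) \<le> C" "t \<in> S" for h t C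
  proof -
    have "m (\<lambda>x. Re (h (x + t))) = m (\<lambda>x. Re (h x))"
      by (rule m_shift[of _ C, OF _ that(2)]) (rule Re_le[OF that(1)])
    moreover have "m (\<lambda>x. Im (h (x + t))) = m (\<lambda>x. Im (h x))"
      by (rule m_shift[of _ C, OF _ that(2)]) (rule Im_le[OF that(1)])
    ultimately show ?thesis by (simp add: M_def)
  qed
  moreover have "M (\<lambda>x. c) = c" for c
    by (simp add: M_def const)
  ultimately show ?thesis using scale by (intro that[of M]) blast+
qed

text \<open>
  The deviation from linearity is additive, vanishes on the integers and is bounded on the unit
  interval, hence bounded; an additive bounded function is zero.
\<close>

lemma additive_lipschitz_real_linear:
  fixes f :: "real \<Rightarrow> 'b::real_normed_vector"
  assumes add: "\<And>s t. f (s + t) = f s + f t" and bound: "\<And>t. norm (f t) \<le> C * \<bar>t\<bar>"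
  shows "f t = t *\<^sub>R f 1"
proof -
  define d where "d t = f t - t *\<^sub>R f 1" for t
  have d_add: "d (s + t) = d s + d t" for s t by (simp add: d_def add algebra_simps)
  have d_0: "d 0 = 0" using d_add[of 0 0] by simp
  have d_minus: "d (- t) = - d t" for t using d_add[of t "- t"] d_0 by (simp add: eq_neg_iff_add_eq_0 add.commute)
  have d_nat_mult: "d (real k * t) = real k *\<^sub>R d t" for k t
    by (induction k) (simp_all add: d_0 d_add algebra_simps)
  have d_int: "d (of_int z) = 0" for z
  proof -
    have "d (of_nat k) = 0" for k using d_nat_mult[of k 1] by (simp add: d_def)
    then show ?thesis using d_minus by (cases z rule: int_cases2) auto
  qed
  define K where "K = C + norm (f 1)"
  have d_bound: "norm (d t) \<le> K * \<bar>t\<bar>" for t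
    using norm_triangle_ineq4[of "f t" "t *\<^sub>R f 1"] bound[of t]
    by (simp add: d_def K_def algebra_simps)
  have K: "K \<ge> 0" using order_trans[OF norm_ge_zero d_bound[of 1]] by simp
  have d_bounded: "norm (d t) \<le> K" for t
  proof -
    have "d t = d (of_int \<lfloor>t\<rfloor> + frac t)" by (simp add: frac_def)
    then have "norm (d t) \<le> K * \<bar>frac t\<bar>" using d_add d_int d_bound[of "frac t"] by simp
    also have "\<dots> \<le> K * 1"
      using K frac_lt_1[of t] by (intro mult_left_mono) (auto simp: frac_ge_0)
    finally show ?thesis by simp
  qed
  have "norm (d t) \<le> K / Suc k" for k
  proof -
    have "norm (real (Suc k) *\<^sub>R d t) \<le> K"
      using d_bounded[of "real (Suc k) * t"] unfolding d_nat_mult .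
    then show ?thesis by (simp add: pos_le_divide_eq mult.commute)
  qed
  moreover have "(\<lambda>k. K / Suc k) \<longlonglongrightarrow> 0" using LIMSEQ_Suc[OF lim_const_over_n[of K]] by simp
  ultimately have "norm (d t) \<le> 0" by (intro LIMSEQ_le_const) auto
  then show ?thesis by (simp add: d_def)
qed

section \<open>Operator norms of matrices\<close>

lemma matrix_opnorm_L2:
  "matrix_opnorm I A = (SUP \<xi>\<in>{\<xi>. L2_set (\<lambda>j. norm (\<xi> j)) I \<le> 1}.
     L2_set (\<lambda>i. norm (\<Sum>j\<in>I. A i j (\<xi> j))) I)"
  by (simp add: matrix_opnorm_def L2_set_def)

lemma matrix_opnorm_le:
  fixes A :: "'i \<Rightarrow> 'i \<Rightarrow> 'h::real_normed_vector \<Rightarrow> 'h"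
  assumes "\<And>\<xi>. L2_set (\<lambda>i. norm (\<Sum>j\<in>I. A i j (\<xi> j))) I \<le> C * L2_set (\<lambda>j. norm (\<xi> j)) I"
    and "C \<ge> 0"
  shows "matrix_opnorm I A \<le> C"
  unfolding matrix_opnorm_L2
proof (rule cSUP_least)
  show "{\<xi>. L2_set (\<lambda>j. norm (\<xi> j)) I \<le> 1} \<noteq> {}"
    by (auto intro!: exI[of _ "\<lambda>_. 0"] simp: L2_set_def)
  fix \<xi> :: "'i \<Rightarrow> 'h" assume "\<xi> \<in> {\<xi>. L2_set (\<lambda>j. norm (\<xi> j)) I \<le> 1}"
  then have "C * L2_set (\<lambda>j. norm (\<xi> j)) I \<le> C * 1"
    using assms(2) by (intro mult_left_mono) auto
  then show "L2_set (\<lambda>i. norm (\<Sum>j\<in>I. A i j (\<xi> j))) I \<le> C"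
    using assms(1)[of \<xi>] by linarith
qed

lemma matrix_opnorm_bdd:
  fixes A :: "'i \<Rightarrow> 'i \<Rightarrow> 'h::real_normed_vector \<Rightarrow> 'h"
  assumes I: "finite I" and A: "\<And>i j. i \<in> I \<Longrightarrow> j \<in> I \<Longrightarrow> bounded_linear (A i j)"
  shows "bdd_above ((\<lambda>\<xi>. L2_set (\<lambda>i. norm (\<Sum>j\<in>I. A i j (\<xi> j))) I) `
           {\<xi>. L2_set (\<lambda>j. norm (\<xi> j)) I \<le> 1})"
proof (rule bdd_aboveI2)
  fix \<xi> :: "'i \<Rightarrow> 'h" assume \<xi>: "\<xi> \<in> {\<xi>. L2_set (\<lambda>j. norm (\<xi> j)) I \<le> 1}"
  have "L2_set (\<lambda>i. norm (\<Sum>j\<in>I. A i j (\<xi> j))) I \<le> (\<Sum>i\<in>I. norm (\<Sum>j\<in>I. A i j (\<xi> j)))"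
    by (rule L2_set_le_sum) simp
  also have "\<dots> \<le> (\<Sum>i\<in>I. \<Sum>j\<in>I. onorm (A i j))"
  proof (intro sum_mono sum_norm_le)
    fix i j assume ij: "i \<in> I" "j \<in> I"
    have "norm (A i j (\<xi> j)) \<le> onorm (A i j) * norm (\<xi> j)" using A[OF ij] by (rule onorm)
    also have "norm (\<xi> j) \<le> L2_set (\<lambda>j. norm (\<xi> j)) I" using I ij(2) by (rule member_le_L2_set)
    also have "\<dots> \<le> 1" using \<xi> by simp
    finally show "norm (A i j (\<xi> j)) \<le> onorm (A i j)"
      using onorm_pos_le[OF A[OF ij]] by (simp add: mult_left_mono)
  qed
  finally show "L2_set (\<lambda>i. norm (\<Sum>j\<in>I. A i j (\<xi> j))) I \<le> (\<Sum>i\<in>I. \<Sum>j\<in>I. onorm (A i j))" .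
qed

lemma matrix_opnorm_nonneg:
  fixes A :: "'i \<Rightarrow> 'i \<Rightarrow> 'h::real_normed_vector \<Rightarrow> 'h"
  assumes I: "finite I" and A: "\<And>i j. i \<in> I \<Longrightarrow> j \<in> I \<Longrightarrow> bounded_linear (A i j)"
  shows "0 \<le> matrix_opnorm I A"
  unfolding matrix_opnorm_L2
  by (rule cSUP_upper2[OF matrix_opnorm_bdd[OF I A], where x = "\<lambda>_. 0"]) (simp_all add: L2_set_def sum_nonneg)

lemma matrix_opnorm_bound:
  fixes A :: "'i \<Rightarrow> 'i \<Rightarrow> 'h::real_normed_vector \<Rightarrow> 'h"
  assumes I: "finite I" and A: "\<And>i j. i \<in> I \<Longrightarrow> j \<in> I \<Longrightarrow> bounded_linear (A i j)"
  shows "L2_set (\<lambda>i. norm (\<Sum>j\<in>I. A i j (\<xi> j))) I \<le> matrix_opnorm I A * L2_set (\<lambda>j. norm (\<xi> j)) I"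
proof (cases "L2_set (\<lambda>j. norm (\<xi> j)) I = 0")
  case True
  then have "\<xi> j = 0" if "j \<in> I" for j using that I by (simp add: L2_set_eq_0_iff)
  then have "(\<Sum>j\<in>I. A i j (\<xi> j)) = 0" if "i \<in> I" for i
    using that A by (intro sum.neutral) (simp add: linear_simps)
  then have "L2_set (\<lambda>i. norm (\<Sum>j\<in>I. A i j (\<xi> j))) I = 0" by (simp add: L2_set_0')
  then show ?thesis using True by simp
next
  case False
  define s where "s = L2_set (\<lambda>j. norm (\<xi> j)) I"
  have s: "s > 0" using False L2_set_nonneg s_def by (metis less_eq_real_def)
  have "L2_set (\<lambda>j. norm ((1/s) *\<^sub>R \<xi> j)) I = 1"
    using s L2_set_right_distrib[of "1/s" "\<lambda>j. norm (\<xi> j)" I] by (simp add: s_def)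
  then have "L2_set (\<lambda>i. norm (\<Sum>j\<in>I. A i j ((1/s) *\<^sub>R \<xi> j))) I \<le> matrix_opnorm I A"
    unfolding matrix_opnorm_L2 by (intro cSUP_upper matrix_opnorm_bdd I A) auto
  also have "L2_set (\<lambda>i. norm (\<Sum>j\<in>I. A i j ((1/s) *\<^sub>R \<xi> j))) I
      = L2_set (\<lambda>i. (1/s) * norm (\<Sum>j\<in>I. A i j (\<xi> j))) I"
  proof (rule L2_set_cong[OF refl])
    fix i assume i: "i \<in> I"
    have "(\<Sum>j\<in>I. A i j ((1/s) *\<^sub>R \<xi> j)) = (\<Sum>j\<in>I. (1/s) *\<^sub>R A i j (\<xi> j))"
      by (rule sum.cong[OF refl]) (rule linear_scale[OF bounded_linear.linear[OF A[OF i]]])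
    then show "norm (\<Sum>j\<in>I. A i j ((1/s) *\<^sub>R \<xi> j)) = (1/s) * norm (\<Sum>j\<in>I. A i j (\<xi> j))"
      using s by (simp flip: scaleR_sum_right)
  qed
  also have "\<dots> = (1/s) * L2_set (\<lambda>i. norm (\<Sum>j\<in>I. A i j (\<xi> j))) I"
    using s L2_set_right_distrib[of "1/s" "\<lambda>i. norm (\<Sum>j\<in>I. A i j (\<xi> j))" I] by simp
  finally show ?thesis using s by (simp add: s_def field_simps)
qed

text \<open>
  This lets an \<open>n \<times> n\<close> matrix be read as an \<open>N \<times> N\<close> matrix without changing its norm.
\<close>

lemma matrix_opnorm_restrict:
  fixes A :: "'i \<Rightarrow> 'i \<Rightarrow> 'h::real_normed_vector \<Rightarrow> 'h"
  assumes J: "finite J" "I \<subseteq> J" and A: "\<And>i j. i \<in> J \<Longrightarrow> j \<in> J \<Longrightarrow> \<not> (i \<in> I \<and> j \<in> I) \<Longrightarrow> A i j = (\<lambda>_. 0)"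
  shows "matrix_opnorm J A = matrix_opnorm I A"
proof -
  have sum_J: "(\<Sum>j\<in>J. A i j (\<xi> j)) = (\<Sum>j\<in>I. A i j (\<xi> j))" if "i \<in> J" for i and \<xi> :: "'i \<Rightarrow> 'h"
    by (rule sum.mono_neutral_right[OF J]) (simp add: A that)
  have norm_J: "L2_set (\<lambda>i. norm (\<Sum>j\<in>J. A i j (\<xi> j))) J = L2_set (\<lambda>i. norm (\<Sum>j\<in>I. A i j (\<xi> j))) I"
    for \<xi> :: "'i \<Rightarrow> 'h"
  proof -
    have "(\<Sum>i\<in>J. (norm (\<Sum>j\<in>J. A i j (\<xi> j)))\<^sup>2) = (\<Sum>i\<in>J. (norm (\<Sum>j\<in>I. A i j (\<xi> j)))\<^sup>2)"
      by (simp add: sum_J)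
    also have "\<dots> = (\<Sum>i\<in>I. (norm (\<Sum>j\<in>I. A i j (\<xi> j)))\<^sup>2)"
      by (rule sum.mono_neutral_right[OF J]) (use J in \<open>auto simp: A subset_iff\<close>)
    finally show ?thesis by (simp add: L2_set_def)
  qed
  have "(\<lambda>\<xi>. L2_set (\<lambda>i. norm (\<Sum>j\<in>I. A i j (\<xi> j))) I) ` {\<xi>. L2_set (\<lambda>j. norm (\<xi> j)) J \<le> 1}
      = (\<lambda>\<xi>. L2_set (\<lambda>i. norm (\<Sum>j\<in>I. A i j (\<xi> j))) I) ` {\<xi>. L2_set (\<lambda>j. norm (\<xi> j)) I \<le> 1}"
    (is "?f ` ?X = ?f ` ?Y")
  proof
    have "(\<Sum>j\<in>I. (norm (\<xi> j))\<^sup>2) \<le> (\<Sum>j\<in>J. (norm (\<xi> j))\<^sup>2)" for \<xi> :: "'i \<Rightarrow> 'h"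
      by (rule sum_mono2[OF J]) simp
    then have "?X \<subseteq> ?Y" by (auto simp: L2_set_def intro: order_trans)
    then show "?f ` ?X \<subseteq> ?f ` ?Y" by blast
    show "?f ` ?Y \<subseteq> ?f ` ?X"
    proof
      fix c assume "c \<in> ?f ` ?Y"
      then obtain \<xi> where \<xi>: "\<xi> \<in> ?Y" "c = ?f \<xi>" by blast
      define \<eta> where "\<eta> j = (if j \<in> I then \<xi> j else 0)" for j
      have "(\<Sum>j\<in>J. (norm (\<eta> j))\<^sup>2) = (\<Sum>j\<in>I. (norm (\<eta> j))\<^sup>2)"
        by (rule sum.mono_neutral_right[OF J]) (simp add: \<eta>_def)
      then have "\<eta> \<in> ?X" using \<xi>(1) by (simp add: L2_set_def \<eta>_def)
      moreover have "?f \<eta> = c" by (simp add: \<xi>(2) \<eta>_def cong: sum.cong)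
      ultimately show "c \<in> ?f ` ?X" by blast
    qed
  qed
  then show ?thesis by (simp add: matrix_opnorm_L2 norm_J)
qed

lemma matrix_opnorm_cong:
  assumes "\<And>i j. i \<in> I \<Longrightarrow> j \<in> I \<Longrightarrow> A i j = B i j"
  shows "matrix_opnorm I A = matrix_opnorm I B"
  unfolding matrix_opnorm_def using assms by (simp cong: sum.cong_simp)

lemma matrix_opnorm_entry:
  fixes A :: "'i \<Rightarrow> 'i \<Rightarrow> 'h::real_normed_vector \<Rightarrow> 'h"
  assumes I: "finite I" and A: "\<And>i j. i \<in> I \<Longrightarrow> j \<in> I \<Longrightarrow> bounded_linear (A i j)"
    and ij: "i \<in> I" "j \<in> I"
  shows "norm (A i j v) \<le> matrix_opnorm I A * norm v"
proof -
  define \<xi> where "\<xi> q = (if q = j then v else 0)" for q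
  have "(\<Sum>q\<in>I. A i q (\<xi> q)) = A i j v"
  proof -
    have "(\<Sum>q\<in>I. A i q (\<xi> q)) = (\<Sum>q\<in>I. if q = j then A i j v else 0)"
      using A[OF ij(1)] by (intro sum.cong) (auto simp: \<xi>_def linear_simps)
    then show ?thesis using I ij by simp
  qed
  then have "norm (A i j v) \<le> L2_set (\<lambda>p. norm (\<Sum>q\<in>I. A p q (\<xi> q))) I"
    using member_le_L2_set[OF I ij(1), of "\<lambda>p. norm (\<Sum>q\<in>I. A p q (\<xi> q))"] by simp
  also have "\<dots> \<le> matrix_opnorm I A * L2_set (\<lambda>q. norm (\<xi> q)) I"
    by (rule matrix_opnorm_bound[OF I A])
  also have "L2_set (\<lambda>q. norm (\<xi> q)) I = norm v"
  proof -
    have "(\<Sum>q\<in>I. (norm (\<xi> q))\<^sup>2) = (\<Sum>q\<in>I. if q = j then (norm v)\<^sup>2 else 0)"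
      by (rule sum.cong) (auto simp: \<xi>_def)
    also have "\<dots> = (norm v)\<^sup>2" using I ij(2) by simp
    finally show ?thesis by (simp add: L2_set_def)
  qed
  finally show ?thesis .
qed

section \<open>Sylvester matrices\<close>

lemma (in complex_hilbert_space) parallelogram:
  fixes x y :: 'h
  shows "(norm (x + y))\<^sup>2 + (norm (x - y))\<^sup>2 = 2 * (norm x)\<^sup>2 + 2 * (norm y)\<^sup>2"
proof -
  have add_right: "ip x (y + z) = ip x y + ip x z" for x y z
    by (metis ip_commute ip_add_left complex_cnj_add)
  have minus_left: "ip (- x) y = - ip x y" for x y
    using ip_add_left[of x "- x" y] ip_add_left[of 0 0 y] by (simp add: eq_neg_iff_add_eq_0 add.commute)
  have minus_right: "ip x (- y) = - ip x y" for x y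
    by (metis ip_commute minus_left complex_cnj_minus)
  have "complex_of_real ((norm (x + y))\<^sup>2 + (norm (x - y))\<^sup>2) = 2 * ip x x + 2 * ip y y"
    unfolding of_real_add ip_self[symmetric] diff_conv_add_uminus[of x y]
    by (simp add: ip_add_left add_right minus_left minus_right del: add_uminus_conv_diff)
  also have "\<dots> = complex_of_real (2 * (norm x)\<^sup>2 + 2 * (norm y)\<^sup>2)"
    by (simp add: ip_self)
  finally show ?thesis by (simp only: of_real_eq_iff)
qed

text \<open>
  Sylvester's Hadamard matrices: of order \<open>2 ^ k\<close>, with entries \<open>\<plusminus>1\<close>, built from four copies of the
  preceding matrix, the last one negated.
\<close>

fun sylvester :: "nat \<Rightarrow> nat \<Rightarrow> nat \<Rightarrow> real" where
  "sylvester 0 i j = 1"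
| "sylvester (Suc k) i j =
     (if 2 ^ k \<le> i \<and> 2 ^ k \<le> j then - 1 else 1) * sylvester k (i mod 2 ^ k) (j mod 2 ^ k)"

lemma sylvester_sign: "sylvester k i j = 1 \<or> sylvester k i j = - 1"
  by (induction k arbitrary: i j) auto

lemma sum_lessThan_double:
  fixes g :: "nat \<Rightarrow> 'a::comm_monoid_add"
  shows "(\<Sum>i<2 * n. g i) = (\<Sum>i<n. g i) + (\<Sum>i<n. g (n + i))"
proof -
  have "(\<Sum>i<n + m. g i) = (\<Sum>i<n. g i) + (\<Sum>i<m. g (n + i))" for m
    by (induction m) (simp_all add: add.assoc)
  then show ?thesis by (simp add: mult_2)
qed

lemma sylvester_blocks:
  assumes "i < 2 ^ k" "j < 2 ^ k"
  shows "sylvester (Suc k) i j = sylvester k i j"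
    and "sylvester (Suc k) (2 ^ k + i) j = sylvester k i j"
    and "sylvester (Suc k) i (2 ^ k + j) = sylvester k i j"
    and "sylvester (Suc k) (2 ^ k + i) (2 ^ k + j) = - sylvester k i j"
  using assms by simp_all

lemma sum_sylvester: "(\<Sum>i<2 ^ k. \<Sum>j<2 ^ k. sylvester k i j) = 2 ^ k"
proof (induction k)
  case (Suc k)
  then show ?case
    by (simp add: sum_lessThan_double sylvester_blocks sum.distrib sum_negf
        del: sylvester.simps cong: sum.cong_simp)
qed simp

lemma sylvester_corner: "sylvester k 0 0 = 1"
  by (induction k) auto

lemma sylvester_neg: "sylvester (Suc k) (2 ^ k) (2 ^ k) = - 1"
  by (simp add: sylvester_corner)

text \<open>
  A Sylvester matrix is \<open>2 ^ (k / 2)\<close> times a unitary.  In the induction step the upper and lower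
  halves of the output are \<open>u + v\<close> and \<open>u - v\<close>, so the parallelogram law doubles the square norm.
\<close>

lemma (in complex_hilbert_space) sylvester_isometry:
  fixes w :: "nat \<Rightarrow> 'h"
  shows "(\<Sum>i<2 ^ k. (norm (\<Sum>j<2 ^ k. sylvester k i j *\<^sub>R w j))\<^sup>2) = 2 ^ k * (\<Sum>j<2 ^ k. (norm (w j))\<^sup>2)"
proof (induction k arbitrary: w)
  case (Suc k)
  define u where "u i = (\<Sum>j<2 ^ k. sylvester k i j *\<^sub>R w j)" for i
  define v where "v i = (\<Sum>j<2 ^ k. sylvester k i j *\<^sub>R w (2 ^ k + j))" for i
  have "(\<Sum>i<2 ^ Suc k. (norm (\<Sum>j<2 ^ Suc k. sylvester (Suc k) i j *\<^sub>R w j))\<^sup>2)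
      = (\<Sum>i<2 ^ k. (norm (u i + v i))\<^sup>2) + (\<Sum>i<2 ^ k. (norm (u i - v i))\<^sup>2)"
    by (simp add: sum_lessThan_double sylvester_blocks u_def v_def sum_negf
        del: sylvester.simps cong: sum.cong_simp)
  also have "\<dots> = 2 * (\<Sum>i<2 ^ k. (norm (u i))\<^sup>2) + 2 * (\<Sum>i<2 ^ k. (norm (v i))\<^sup>2)"
    by (simp add: sum.distrib[symmetric] sum_distrib_left parallelogram[of "u _" "v _"])
  also have "\<dots> = 2 ^ Suc k * (\<Sum>j<2 ^ Suc k. (norm (w j))\<^sup>2)"
    using Suc[of w] Suc[of "\<lambda>j. w (2 ^ k + j)"]
    by (simp add: u_def v_def sum_lessThan_double algebra_simps)
  finally show ?case .
qed simp

section \<open>Norms of scalar matrices and of matrices of functionals\<close>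

lemma scalar_matrix_form_le:
  fixes \<alpha> :: "'i \<Rightarrow> 'i \<Rightarrow> complex"
  assumes I: "finite I"
  shows "cmod (\<Sum>p\<in>I. \<Sum>q\<in>I. b p * \<alpha> p q * a q)
    \<le> matrix_opnorm I (\<lambda>p q z. \<alpha> p q * z) * (L2_set (\<lambda>p. cmod (a p)) I * L2_set (\<lambda>p. cmod (b p)) I)"
proof -
  have "cmod (\<Sum>p\<in>I. \<Sum>q\<in>I. b p * \<alpha> p q * a q) = cmod (\<Sum>p\<in>I. b p * (\<Sum>q\<in>I. \<alpha> p q * a q))"
    by (simp add: sum_distrib_left mult.assoc)
  also have "\<dots> \<le> (\<Sum>p\<in>I. \<bar>cmod (b p)\<bar> * \<bar>cmod (\<Sum>q\<in>I. \<alpha> p q * a q)\<bar>)"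
    by (rule sum_norm_le) (simp add: norm_mult)
  also have "\<dots> \<le> L2_set (\<lambda>p. cmod (b p)) I * L2_set (\<lambda>p. cmod (\<Sum>q\<in>I. \<alpha> p q * a q)) I"
    by (rule L2_set_mult_ineq)
  also have "\<dots> \<le> L2_set (\<lambda>p. cmod (b p)) I *
      (matrix_opnorm I (\<lambda>p q z. \<alpha> p q * z) * L2_set (\<lambda>p. cmod (a p)) I)"
    by (intro mult_left_mono matrix_opnorm_bound[OF I]) (auto intro: bounded_linear_mult_right)
  finally show ?thesis by (simp add: mult_ac)
qed

text \<open>
  Taking for \<open>b\<close> the conjugate of the image of \<open>a\<close> turns the form into the square of the norm of
  that image.
\<close>

lemma scalar_matrix_opnorm_le:
  fixes \<alpha> :: "'i \<Rightarrow> 'i \<Rightarrow> complex"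
  assumes C: "C \<ge> 0"
    and form: "\<And>a b. cmod (\<Sum>p\<in>I. \<Sum>q\<in>I. b p * \<alpha> p q * a q)
      \<le> C * (L2_set (\<lambda>p. cmod (a p)) I * L2_set (\<lambda>p. cmod (b p)) I)"
  shows "matrix_opnorm I (\<lambda>p q z. \<alpha> p q * z) \<le> C"
proof (rule matrix_opnorm_le[OF _ C])
  fix a :: "'i \<Rightarrow> complex"
  define z where "z p = (\<Sum>q\<in>I. \<alpha> p q * a q)" for p
  define s where "s = L2_set (\<lambda>p. cmod (z p)) I"
  have "(\<Sum>p\<in>I. \<Sum>q\<in>I. cnj (z p) * \<alpha> p q * a q) = (\<Sum>p\<in>I. cnj (z p) * z p)"
    by (simp add: z_def sum_distrib_left mult.assoc)
  also have "\<dots> = complex_of_real (\<Sum>p\<in>I. (cmod (z p))\<^sup>2)"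
    by (simp only: of_real_sum complex_norm_square mult.commute)
  also have "\<dots> = complex_of_real (s\<^sup>2)"
    by (simp add: s_def L2_set_def sum_nonneg)
  finally have "s\<^sup>2 \<le> C * (L2_set (\<lambda>p. cmod (a p)) I * s)"
    using form[of "\<lambda>p. cnj (z p)" a] by (simp add: s_def norm_power)
  then have "s \<le> C * L2_set (\<lambda>p. cmod (a p)) I \<or> s = 0"
    using L2_set_nonneg[of "\<lambda>p. cmod (z p)" I] unfolding s_def[symmetric]
    by (auto simp: power2_eq_square mult.assoc[symmetric])
  then show "L2_set (\<lambda>p. cmod (\<Sum>q\<in>I. \<alpha> p q * a q)) I \<le> C * L2_set (\<lambda>q. cmod (a q)) I"
    using C by (auto simp: s_def z_def)
qed

text \<open>
  The condition that the matrix \<open>F\<close> of functionals has cb-norm at most \<open>C\<close>, phrased through the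
  bilinear forms of the scalar matrices \<open>F k l (y i j)\<close>.  Rows and columns of these are indexed by
  pairs \<open>(i, k)\<close>.  In this form the condition is visibly stable under sums, multiples and
  conjugation, and it makes sense before the suprema defining the norm are known to be finite.
\<close>

definition form_bounded ::
  "('a::ab_group_add) matrix_normed \<Rightarrow> nat \<Rightarrow> (nat \<Rightarrow> nat \<Rightarrow> 'a \<Rightarrow> complex) \<Rightarrow> real \<Rightarrow> bool" where
  "form_bounded V n F C \<longleftrightarrow>
     (\<forall>m y a b. 1 \<le> m \<longrightarrow> y \<in> matrices m V \<longrightarrow> os_norm V m y \<le> 1 \<longrightarrow>
        cmod (\<Sum>p\<in>{..<m} \<times> {..<n}. \<Sum>q\<in>{..<m} \<times> {..<n}.
                b p * F (snd p) (snd q) (y (fst p) (fst q)) * a q)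
        \<le> C * (L2_set (\<lambda>p. cmod (a p)) ({..<m} \<times> {..<n}) * L2_set (\<lambda>p. cmod (b p)) ({..<m} \<times> {..<n})))"

lemma form_boundedD:
  assumes "form_bounded V n F C" "1 \<le> m" "y \<in> matrices m V" "os_norm V m y \<le> 1"
  shows "cmod (\<Sum>p\<in>{..<m} \<times> {..<n}. \<Sum>q\<in>{..<m} \<times> {..<n}.
                b p * F (snd p) (snd q) (y (fst p) (fst q)) * a q)
        \<le> C * (L2_set (\<lambda>p. cmod (a p)) ({..<m} \<times> {..<n}) * L2_set (\<lambda>p. cmod (b p)) ({..<m} \<times> {..<n}))"
  using assms unfolding form_bounded_def by blast

lemma form_bounded_mono:
  assumes "form_bounded V n F C" "C \<le> C'"
  shows "form_bounded V n F C'"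
  using assms unfolding form_bounded_def
  by (meson L2_set_nonneg mult_nonneg_nonneg mult_right_mono order_trans)

lemma form_bounded_add:
  assumes "form_bounded V n F C" "form_bounded V n G D"
  shows "form_bounded V n (\<lambda>k l y. F k l y + G k l y) (C + D)"
  unfolding form_bounded_def
proof (intro allI impI)
  fix m y and a b :: "nat \<times> nat \<Rightarrow> complex"
  assume y: "1 \<le> m" "y \<in> matrices m V" "os_norm V m y \<le> 1"
  show "cmod (\<Sum>p\<in>{..<m} \<times> {..<n}. \<Sum>q\<in>{..<m} \<times> {..<n}.
      b p * (F (snd p) (snd q) (y (fst p) (fst q)) + G (snd p) (snd q) (y (fst p) (fst q))) * a q)
    \<le> (C + D) * (L2_set (\<lambda>p. cmod (a p)) ({..<m} \<times> {..<n}) * L2_set (\<lambda>p. cmod (b p)) ({..<m} \<times> {..<n}))"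
    using form_boundedD[OF assms(1) y, of b a] form_boundedD[OF assms(2) y, of b a]
    by (simp add: distrib_left distrib_right sum.distrib norm_triangle_le)
qed

lemma form_bounded_scale:
  assumes "form_bounded V n F C"
  shows "form_bounded V n (\<lambda>k l y. c * F k l y) (cmod c * C)"
  unfolding form_bounded_def
proof (intro allI impI)
  fix m y and a b :: "nat \<times> nat \<Rightarrow> complex"
  assume y: "1 \<le> m" "y \<in> matrices m V" "os_norm V m y \<le> 1"
  have "(\<Sum>p\<in>{..<m} \<times> {..<n}. \<Sum>q\<in>{..<m} \<times> {..<n}.
      b p * (c * F (snd p) (snd q) (y (fst p) (fst q))) * a q)
    = c * (\<Sum>p\<in>{..<m} \<times> {..<n}. \<Sum>q\<in>{..<m} \<times> {..<n}.
      b p * F (snd p) (snd q) (y (fst p) (fst q)) * a q)"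
    by (simp add: sum_distrib_left mult_ac)
  then show "cmod (\<Sum>p\<in>{..<m} \<times> {..<n}. \<Sum>q\<in>{..<m} \<times> {..<n}.
      b p * (c * F (snd p) (snd q) (y (fst p) (fst q))) * a q)
    \<le> cmod c * C * (L2_set (\<lambda>p. cmod (a p)) ({..<m} \<times> {..<n}) * L2_set (\<lambda>p. cmod (b p)) ({..<m} \<times> {..<n}))"
    using mult_left_mono[OF form_boundedD[OF assms y, of b a], of "cmod c"]
    by (simp add: norm_mult mult.assoc)
qed

lemma form_bounded_cnj:
  assumes "form_bounded V n F C"
  shows "form_bounded V n (\<lambda>k l y. cnj (F k l y)) C"
  unfolding form_bounded_def
proof (intro allI impI)
  fix m y and a b :: "nat \<times> nat \<Rightarrow> complex"
  assume y: "1 \<le> m" "y \<in> matrices m V" "os_norm V m y \<le> 1"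
  have "cmod (\<Sum>p\<in>{..<m} \<times> {..<n}. \<Sum>q\<in>{..<m} \<times> {..<n}.
      b p * cnj (F (snd p) (snd q) (y (fst p) (fst q))) * a q)
    = cmod (cnj (\<Sum>p\<in>{..<m} \<times> {..<n}. \<Sum>q\<in>{..<m} \<times> {..<n}.
      cnj (b p) * F (snd p) (snd q) (y (fst p) (fst q)) * cnj (a q)))"
    by simp
  also have "\<dots> = cmod (\<Sum>p\<in>{..<m} \<times> {..<n}. \<Sum>q\<in>{..<m} \<times> {..<n}.
      cnj (b p) * F (snd p) (snd q) (y (fst p) (fst q)) * cnj (a q))"
    by (rule complex_mod_cnj)
  finally show "cmod (\<Sum>p\<in>{..<m} \<times> {..<n}. \<Sum>q\<in>{..<m} \<times> {..<n}.
      b p * cnj (F (snd p) (snd q) (y (fst p) (fst q))) * a q)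
    \<le> C * (L2_set (\<lambda>p. cmod (a p)) ({..<m} \<times> {..<n}) * L2_set (\<lambda>p. cmod (b p)) ({..<m} \<times> {..<n}))"
    using form_boundedD[OF assms y, of "\<lambda>p. cnj (b p)" "\<lambda>p. cnj (a p)"] by simp
qed

text \<open>
  Inside the index range the amplification in the definition of the norm disappears.
\<close>

lemma os_norm_dual:
  "os_norm (dual_os V) n F =
     (SUP (m, y)\<in>{(m, y). 1 \<le> m \<and> y \<in> matrices m V \<and> os_norm V m y \<le> 1}.
        matrix_opnorm ({..<m} \<times> {..<n}) (\<lambda>p q z. F (snd p) (snd q) (y (fst p) (fst q)) * z))"
proof -
  have "os_norm (scalar_matrices_os n) m (amplification m (\<lambda>y i j. F i j y) y)
      = matrix_opnorm ({..<m} \<times> {..<n}) (\<lambda>p q z. F (snd p) (snd q) (y (fst p) (fst q)) * z)" for m y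
    unfolding scalar_matrices_os_def matrix_normed.simps
    by (rule matrix_opnorm_cong) (auto simp: amplification_def)
  then show ?thesis by (simp add: dual_os_def cb_norm_def)
qed

lemma dual_norm_le:
  assumes "form_bounded V n F C" "0 \<le> C" "0 \<in> os_carrier V" "os_norm V 1 0 \<le> 1"
  shows "os_norm (dual_os V) n F \<le> C"
  unfolding os_norm_dual
proof (rule cSUP_least)
  have "(0 :: nat \<Rightarrow> nat \<Rightarrow> 'a) \<in> matrices 1 V" using assms(3) by (simp add: matrices_def)
  then have "(1, 0) \<in> {(m, y). 1 \<le> m \<and> y \<in> matrices m V \<and> os_norm V m y \<le> 1}"
    using assms(4) by simp
  then show "{(m, y). 1 \<le> m \<and> y \<in> matrices m V \<and> os_norm V m y \<le> 1} \<noteq> {}" by blast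
  show "(case my of (m, y) \<Rightarrow>
      matrix_opnorm ({..<m} \<times> {..<n}) (\<lambda>p q z. F (snd p) (snd q) (y (fst p) (fst q)) * z)) \<le> C"
    if "my \<in> {(m, y). 1 \<le> m \<and> y \<in> matrices m V \<and> os_norm V m y \<le> 1}" for my
    using that assms(2)
    by (auto intro!: scalar_matrix_opnorm_le form_boundedD[OF assms(1)] split: prod.split)
qed

lemma dual_norm_upper:
  assumes F: "form_bounded V n F C" and y: "1 \<le> m" "y \<in> matrices m V" "os_norm V m y \<le> 1"
  shows "matrix_opnorm ({..<m} \<times> {..<n}) (\<lambda>p q z. F (snd p) (snd q) (y (fst p) (fst q)) * z)
    \<le> os_norm (dual_os V) n F"
proof -
  let ?g = "\<lambda>(m, y). matrix_opnorm ({..<m} \<times> {..<n}) (\<lambda>p q z. F (snd p) (snd q) (y (fst p) (fst q)) * z)"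
  have "form_bounded V n F \<bar>C\<bar>" using F by (rule form_bounded_mono) simp
  then have "bdd_above (?g ` {(m, y). 1 \<le> m \<and> y \<in> matrices m V \<and> os_norm V m y \<le> 1})"
    by (intro bdd_aboveI2[of _ _ "\<bar>C\<bar>"])
      (auto intro!: scalar_matrix_opnorm_le form_boundedD split: prod.split)
  then have "?g (m, y) \<le> os_norm (dual_os V) n F"
    unfolding os_norm_dual using y by (intro cSUP_upper) auto
  then show ?thesis by simp
qed

text \<open>
  Some bound \<open>C\<close> has to be known already: it shows that the supremum defining the norm is taken over
  a bounded set.
\<close>

lemma form_bounded_dual_norm:
  assumes "form_bounded V n F C"
  shows "form_bounded V n F (os_norm (dual_os V) n F)"
  unfolding form_bounded_def
proof (intro allI impI)
  fix m y and a b :: "nat \<times> nat \<Rightarrow> complex"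
  assume y: "1 \<le> m" "y \<in> matrices m V" "os_norm V m y \<le> 1"
  have "cmod (\<Sum>p\<in>{..<m} \<times> {..<n}. \<Sum>q\<in>{..<m} \<times> {..<n}.
      b p * F (snd p) (snd q) (y (fst p) (fst q)) * a q)
    \<le> matrix_opnorm ({..<m} \<times> {..<n}) (\<lambda>p q z. F (snd p) (snd q) (y (fst p) (fst q)) * z) *
      (L2_set (\<lambda>p. cmod (a p)) ({..<m} \<times> {..<n}) * L2_set (\<lambda>p. cmod (b p)) ({..<m} \<times> {..<n}))"
    by (rule scalar_matrix_form_le) simp
  also have "\<dots> \<le> os_norm (dual_os V) n F *
      (L2_set (\<lambda>p. cmod (a p)) ({..<m} \<times> {..<n}) * L2_set (\<lambda>p. cmod (b p)) ({..<m} \<times> {..<n}))"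
    by (intro mult_right_mono dual_norm_upper[OF assms y] mult_nonneg_nonneg L2_set_nonneg)
  finally show "cmod (\<Sum>p\<in>{..<m} \<times> {..<n}. \<Sum>q\<in>{..<m} \<times> {..<n}.
      b p * F (snd p) (snd q) (y (fst p) (fst q)) * a q)
    \<le> os_norm (dual_os V) n F *
      (L2_set (\<lambda>p. cmod (a p)) ({..<m} \<times> {..<n}) * L2_set (\<lambda>p. cmod (b p)) ({..<m} \<times> {..<n}))" .
qed

lemma dual_norm_nonneg:
  assumes "form_bounded V n F C" "0 \<in> os_carrier V" "os_norm V 1 0 \<le> 1"
  shows "0 \<le> os_norm (dual_os V) n F"
proof -
  have "(0 :: nat \<Rightarrow> nat \<Rightarrow> 'a) \<in> matrices 1 V" using assms(2) by (simp add: matrices_def)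
  note upper = dual_norm_upper[OF assms(1) order_refl this assms(3)]
  show ?thesis
    by (rule order_trans[OF matrix_opnorm_nonneg upper]) (auto intro: bounded_linear_mult_right)
qed

lemma dual_norm_restrict:
  assumes "n \<le> N" and F: "\<And>k l. \<not> (k < n \<and> l < n) \<Longrightarrow> F k l = 0"
  shows "os_norm (dual_os V) N F = os_norm (dual_os V) n F"
proof -
  have "matrix_opnorm ({..<m} \<times> {..<N}) (\<lambda>p q z. F (snd p) (snd q) (y (fst p) (fst q)) * z)
      = matrix_opnorm ({..<m} \<times> {..<n}) (\<lambda>p q z. F (snd p) (snd q) (y (fst p) (fst q)) * z)" for m :: nat and y
  proof (rule matrix_opnorm_restrict)
    show "finite ({..<m} \<times> {..<N})" by simp
    show "{..<m} \<times> {..<n} \<subseteq> {..<m} \<times> {..<N}" using assms(1) by auto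
    fix p q
    assume "p \<in> {..<m} \<times> {..<N}" "q \<in> {..<m} \<times> {..<N}"
      "\<not> (p \<in> {..<m} \<times> {..<n} \<and> q \<in> {..<m} \<times> {..<n})"
    then have "F (snd p) (snd q) = 0" by (intro F) auto
    then show "(\<lambda>z. F (snd p) (snd q) (y (fst p) (fst q)) * z) = (\<lambda>_. 0)" by simp
  qed
  then show ?thesis by (simp add: os_norm_dual)
qed

section \<open>Operator spaces and their functionals\<close>

lemma (in complex_hilbert_space) norm_smul: "norm (smul a x) = cmod a * norm x"
proof -
  have ip_smul_right: "ip x (smul a y) = cnj a * ip x y" for x y a
    by (metis ip_commute ip_smul_left complex_cnj_mult)
  have "complex_of_real ((norm (smul a x))\<^sup>2) = a * (cnj a * ip x x)"
    unfolding ip_self[symmetric] by (simp add: ip_smul_left ip_smul_right mult.left_commute)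
  also have "\<dots> = complex_of_real ((cmod a * norm x)\<^sup>2)"
    by (simp only: ip_self complex_norm_square[symmetric] mult.assoc[symmetric] of_real_mult
        power_mult_distrib)
  finally have "(norm (smul a x))\<^sup>2 = (cmod a * norm x)\<^sup>2" by (simp only: of_real_eq_iff)
  then show ?thesis by (simp add: power2_eq_iff_nonneg)
qed

lemma (in complex_hilbert_space) bounded_linear_smul: "bounded_linear (smul a)"
proof (rule bounded_linear_intro)
  show "smul a (x + y) = smul a x + smul a y" for x y by (rule scale_right_distrib)
  show "smul a (r *\<^sub>R x) = r *\<^sub>R smul a x" for r x by (metis smul_of_real scale_left_commute)
  show "norm (smul a x) \<le> norm x * cmod a" for x by (simp add: norm_smul mult.commute)
qed

lemma (in complex_hilbert_space) op_smul_apply [simp]: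
  "blinfun_apply (op_smul smul a T) \<xi> = smul a (blinfun_apply T \<xi>)"
  unfolding op_smul_def
  by (subst bounded_linear_Blinfun_apply)
    (auto intro: bounded_linear_compose[OF bounded_linear_smul blinfun.bounded_linear_right])

lemma (in complex_hilbert_space) module_op_smul: "module (op_smul smul)"
  by (unfold_locales; rule blinfun_eqI)
    (simp_all add: blinfun.add_left scale_right_distrib scale_left_distrib)

locale concrete_operator_space = complex_hilbert_space smul ip
  for smul :: "complex \<Rightarrow> 'h::banach \<Rightarrow> 'h" and ip +
  fixes X :: "('h \<Rightarrow>\<^sub>L 'h) set"
  assumes operator_space: "operator_space smul X"
begin

abbreviation V where "V \<equiv> concrete_os smul X"

lemma carrier [simp]: "os_carrier V = X" and smul_V [simp]: "os_smul V = op_smul smul"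
  by (simp_all add: concrete_os_def)

lemma os_norm_V: "os_norm V n x = matrix_opnorm {..<n} (\<lambda>i j. blinfun_apply (x i j))"
  by (simp add: concrete_os_def)

lemma subspace_X: "module.subspace (op_smul smul) X"
  using operator_space by (simp add: operator_space_def)

lemma zero_mem: "0 \<in> X" and add_mem: "x \<in> X \<Longrightarrow> y \<in> X \<Longrightarrow> x + y \<in> X"
  and smul_mem: "x \<in> X \<Longrightarrow> op_smul smul a x \<in> X"
  and diff_mem: "x \<in> X \<Longrightarrow> y \<in> X \<Longrightarrow> x - y \<in> X"
  using module.subspace_0[OF module_op_smul subspace_X] module.subspace_add[OF module_op_smul subspace_X]
    module.subspace_scale[OF module_op_smul subspace_X] module.subspace_diff[OF module_op_smul subspace_X]
  by blast+

lemma op_smul_of_real: "op_smul smul (of_real r) x = r *\<^sub>R x"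
  by (rule blinfun_eqI) (simp add: smul_of_real blinfun.scaleR_left)

lemma scaleR_mem: "x \<in> X \<Longrightarrow> r *\<^sub>R x \<in> X"
  using smul_mem[of x "of_real r"] by (simp only: op_smul_of_real)

lemma sum_mem: "(\<And>i. i \<in> I \<Longrightarrow> T i \<in> X) \<Longrightarrow> (\<Sum>i\<in>I. T i) \<in> X"
  by (rule module.subspace_sum[OF module_op_smul subspace_X])

lemma apply_smul: "T \<in> X \<Longrightarrow> blinfun_apply T (smul a \<xi>) = smul a (blinfun_apply T \<xi>)"
proof -
  assume "T \<in> X"
  then have "Vector_Spaces.linear smul smul (blinfun_apply T)"
    using operator_space by (auto simp: operator_space_def bounded_operators_def)
  then show ?thesis by (rule module_hom.scale[OF Vector_Spaces.linear.axioms(3)])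
qed

lemma matrices_mem: "x \<in> matrices n V \<Longrightarrow> x i j \<in> X"
  using zero_mem by (cases "i < n \<and> j < n") (auto simp: matrices_def)

lemma matrices_diff: "x \<in> matrices n V \<Longrightarrow> y \<in> matrices n V \<Longrightarrow> x - y \<in> matrices n V"
  using diff_mem by (auto simp: matrices_def)

lemma zero_matrix: "0 \<in> matrices n V"
  by (simp add: matrices_def zero_mem)

lemma os_norm_bound:
  "L2_set (\<lambda>i. norm (\<Sum>j<n. blinfun_apply (x i j) (\<xi> j))) {..<n}
    \<le> os_norm V n x * L2_set (\<lambda>j. norm (\<xi> j)) {..<n}"
  unfolding os_norm_V by (rule matrix_opnorm_bound) (auto intro: blinfun.bounded_linear_right)

lemma os_norm_le:
  assumes "C \<ge> 0"
    and "\<And>\<xi>. L2_set (\<lambda>i. norm (\<Sum>j<n. blinfun_apply (x i j) (\<xi> j))) {..<n}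
      \<le> C * L2_set (\<lambda>j. norm (\<xi> j)) {..<n}"
  shows "os_norm V n x \<le> C"
  unfolding os_norm_V using assms by (intro matrix_opnorm_le)

lemma os_norm_nonneg: "0 \<le> os_norm V n x"
  unfolding os_norm_V by (rule matrix_opnorm_nonneg) (auto intro: blinfun.bounded_linear_right)

lemma os_norm_entry:
  assumes "i < n" "j < n"
  shows "norm (x i j) \<le> os_norm V n x"
proof (rule norm_blinfun_bound[OF os_norm_nonneg])
  show "norm (blinfun_apply (x i j) v) \<le> os_norm V n x * norm v" for v
    unfolding os_norm_V
    using matrix_opnorm_entry[of "{..<n}" "\<lambda>i j. blinfun_apply (x i j)" i j v] assms
    by (auto intro: blinfun.bounded_linear_right)
qed

lemma os_norm_one: "os_norm V 1 x = norm (x 0 0)"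
proof (rule antisym)
  show "os_norm V 1 x \<le> norm (x 0 0)"
    by (rule os_norm_le) (simp_all add: lessThan_Suc norm_blinfun)
  show "norm (x 0 0) \<le> os_norm V 1 x" by (rule os_norm_entry) simp_all
qed

lemma os_norm_restrict:
  assumes "x \<in> matrices n V" "n \<le> N"
  shows "os_norm V N x = os_norm V n x"
  unfolding os_norm_V
  by (rule matrix_opnorm_restrict) (use assms in \<open>auto simp: matrices_def\<close>)

lemma os_norm_smul:
  assumes "x \<in> matrices n V"
  shows "os_norm V n (\<lambda>i j. op_smul smul a (x i j)) \<le> cmod a * os_norm V n x"
proof (rule os_norm_le)
  fix \<xi>
  have "(\<Sum>j<n. blinfun_apply (op_smul smul a (x i j)) (\<xi> j))
      = smul a (\<Sum>j<n. blinfun_apply (x i j) (\<xi> j))" for i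
    by (simp add: scale_sum_right)
  then have "L2_set (\<lambda>i. norm (\<Sum>j<n. blinfun_apply (op_smul smul a (x i j)) (\<xi> j))) {..<n}
      = cmod a * L2_set (\<lambda>i. norm (\<Sum>j<n. blinfun_apply (x i j) (\<xi> j))) {..<n}"
    by (simp add: norm_smul L2_set_right_distrib)
  also have "\<dots> \<le> cmod a * (os_norm V n x * L2_set (\<lambda>j. norm (\<xi> j)) {..<n})"
    by (rule mult_left_mono[OF os_norm_bound]) simp
  finally show "L2_set (\<lambda>i. norm (\<Sum>j<n. blinfun_apply (op_smul smul a (x i j)) (\<xi> j))) {..<n}
      \<le> cmod a * os_norm V n x * L2_set (\<lambda>j. norm (\<xi> j)) {..<n}" by (simp add: mult.assoc)
qed (simp add: os_norm_nonneg)

text \<open>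
  The Sylvester matrix of order \<open>N\<close> tensored with \<open>v\<close> has norm only \<open>\<surd>N \<parallel>v\<parallel>\<close>, whereas a matrix all of
  whose entries are \<open>v\<close> has norm \<open>N \<parallel>v\<parallel>\<close>.  The gap is what forces near additivity below.
\<close>

lemma os_norm_sylvester:
  "os_norm V (2 ^ k) (\<lambda>i j. if i < 2 ^ k \<and> j < 2 ^ k then sylvester k i j *\<^sub>R v else 0) \<le> sqrt (2 ^ k) * norm v"
proof (rule os_norm_le)
  fix \<xi>
  have "L2_set (\<lambda>i. norm (\<Sum>j<2 ^ k. blinfun_apply
          (if i < 2 ^ k \<and> j < 2 ^ k then sylvester k i j *\<^sub>R v else 0) (\<xi> j))) {..<2 ^ k}
      = L2_set (\<lambda>i. norm (\<Sum>j<2 ^ k. sylvester k i j *\<^sub>R blinfun_apply v (\<xi> j))) {..<2 ^ k}"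
    by (rule L2_set_cong) (simp_all add: blinfun.scaleR_left cong: sum.cong_simp)
  also have "\<dots> = sqrt (2 ^ k) * L2_set (\<lambda>j. norm (blinfun_apply v (\<xi> j))) {..<2 ^ k}"
    unfolding L2_set_def sylvester_isometry by (simp add: real_sqrt_mult)
  also have "\<dots> \<le> sqrt (2 ^ k) * L2_set (\<lambda>j. norm v * norm (\<xi> j)) {..<2 ^ k}"
    by (intro mult_left_mono L2_set_mono) (auto simp: norm_blinfun)
  finally show "L2_set (\<lambda>i. norm (\<Sum>j<2 ^ k. blinfun_apply
          (if i < 2 ^ k \<and> j < 2 ^ k then sylvester k i j *\<^sub>R v else 0) (\<xi> j))) {..<2 ^ k}
      \<le> sqrt (2 ^ k) * norm v * L2_set (\<lambda>j. norm (\<xi> j)) {..<2 ^ k}"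
    by (simp add: L2_set_right_distrib[symmetric] mult.assoc)
qed simp

text \<open>
  The sum is the product of the row \<open>b\<close>, the operator matrix \<open>y\<close> and the column \<open>a\<close>.
\<close>

lemma norm_compression_le:
  assumes y: "y \<in> matrices m V"
  shows "norm (\<Sum>i<m. \<Sum>j<m. op_smul smul (b i * a j) (y i j))
    \<le> os_norm V m y * (L2_set (\<lambda>j. cmod (a j)) {..<m} * L2_set (\<lambda>i. cmod (b i)) {..<m})"
    (is "norm ?T \<le> ?C")
proof (rule norm_blinfun_bound)
  show "0 \<le> ?C" by (simp add: os_norm_nonneg)
  fix \<xi>
  define w where "w i = (\<Sum>j<m. blinfun_apply (y i j) (smul (a j) \<xi>))" for i
  have "blinfun_apply ?T \<xi> = (\<Sum>i<m. smul (b i) (w i))"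
    by (simp add: w_def blinfun.sum_left scale_sum_right apply_smul[OF matrices_mem[OF y]])
  also have "norm \<dots> \<le> (\<Sum>i<m. \<bar>cmod (b i)\<bar> * \<bar>norm (w i)\<bar>)"
    by (rule sum_norm_le) (simp add: norm_smul)
  also have "\<dots> \<le> L2_set (\<lambda>i. cmod (b i)) {..<m} * L2_set (\<lambda>i. norm (w i)) {..<m}"
    by (rule L2_set_mult_ineq)
  also have "\<dots> \<le> L2_set (\<lambda>i. cmod (b i)) {..<m} *
      (os_norm V m y * L2_set (\<lambda>j. norm (smul (a j) \<xi>)) {..<m})"
    unfolding w_def by (intro mult_left_mono os_norm_bound) simp
  also have "L2_set (\<lambda>j. norm (smul (a j) \<xi>)) {..<m} = L2_set (\<lambda>j. cmod (a j)) {..<m} * norm \<xi>"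
    by (simp add: norm_smul L2_set_left_distrib)
  finally show "norm (blinfun_apply ?T \<xi>) \<le> ?C * norm \<xi>" by (simp add: mult_ac)
qed

lemma dual_carrier_iff:
  "\<phi> \<in> os_carrier (dual_os V) \<longleftrightarrow>
     (\<forall>x\<in>X. \<forall>y\<in>X. \<phi> (x + y) = \<phi> x + \<phi> y) \<and> (\<forall>a. \<forall>x\<in>X. \<phi> (op_smul smul a x) = a * \<phi> x) \<and>
     (\<exists>C. \<forall>x\<in>X. cmod (\<phi> x) \<le> C * norm x) \<and> (\<forall>y. y \<notin> X \<longrightarrow> \<phi> y = 0)"
proof -
  have "(\<forall>x\<in>matrices 1 V. cmod (\<phi> (x 0 0)) \<le> C * os_norm V 1 x)
      \<longleftrightarrow> (\<forall>x\<in>X. cmod (\<phi> x) \<le> C * norm x)" for C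
  proof
    assume *: "\<forall>x\<in>matrices 1 V. cmod (\<phi> (x 0 0)) \<le> C * os_norm V 1 x"
    show "\<forall>x\<in>X. cmod (\<phi> x) \<le> C * norm x"
    proof
      fix x assume "x \<in> X"
      then have "(\<lambda>i j. if i < 1 \<and> j < 1 then x else 0) \<in> matrices 1 V" by (auto simp: matrices_def)
      from bspec[OF * this] show "cmod (\<phi> x) \<le> C * norm x" unfolding os_norm_one by simp
    qed
  next
    assume "\<forall>x\<in>X. cmod (\<phi> x) \<le> C * norm x"
    then show "\<forall>x\<in>matrices 1 V. cmod (\<phi> (x 0 0)) \<le> C * os_norm V 1 x"
      unfolding os_norm_one using matrices_mem by blast
  qed
  then show ?thesis by (simp add: dual_os_def clinear_on_def)
qed

lemma dual_add: "\<phi> \<in> os_carrier (dual_os V) \<Longrightarrow> x \<in> X \<Longrightarrow> y \<in> X \<Longrightarrow> \<phi> (x + y) = \<phi> x + \<phi> y"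
  and dual_smul: "\<phi> \<in> os_carrier (dual_os V) \<Longrightarrow> x \<in> X \<Longrightarrow> \<phi> (op_smul smul a x) = a * \<phi> x"
  by (auto simp: dual_carrier_iff)

lemma dual_lin_comb:
  assumes "\<phi> \<in> os_carrier (dual_os V)" "\<psi> \<in> os_carrier (dual_os V)"
  shows "(\<lambda>y. c * \<phi> y + d * \<psi> y) \<in> os_carrier (dual_os V)"
proof -
  obtain C where C: "\<forall>x\<in>X. cmod (\<phi> x) \<le> C * norm x"
    using assms(1) by (auto simp: dual_carrier_iff)
  obtain D where D: "\<forall>x\<in>X. cmod (\<psi> x) \<le> D * norm x"
    using assms(2) by (auto simp: dual_carrier_iff)
  have "cmod (c * \<phi> x + d * \<psi> x) \<le> (cmod c * C + cmod d * D) * norm x" if "x \<in> X" for x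
    using mult_left_mono[OF bspec[OF C that], of "cmod c"] mult_left_mono[OF bspec[OF D that], of "cmod d"]
    by (intro norm_triangle_le) (simp add: norm_mult algebra_simps)
  then have "\<exists>K. \<forall>x\<in>X. cmod (c * \<phi> x + d * \<psi> x) \<le> K * norm x" by blast
  then show ?thesis using assms unfolding dual_carrier_iff by (simp add: algebra_simps)
qed

lemma dual_diff:
  assumes "\<phi> \<in> os_carrier (dual_os V)" "\<psi> \<in> os_carrier (dual_os V)"
  shows "\<phi> - \<psi> \<in> os_carrier (dual_os V)"
  using dual_lin_comb[OF assms, of 1 "-1"] by (simp add: fun_diff_def)

lemma dual_zero: "0 \<in> os_carrier (dual_os V)"
  by (simp add: dual_carrier_iff) (metis norm_ge_zero mult_zero_left order_refl)

lemma dual_sum: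
  assumes \<phi>: "\<phi> \<in> os_carrier (dual_os V)" and T: "\<And>i. i \<in> I \<Longrightarrow> T i \<in> X"
  shows "\<phi> (\<Sum>i\<in>I. T i) = (\<Sum>i\<in>I. \<phi> (T i))"
proof -
  have "\<phi> 0 = 0" using dual_add[OF \<phi> zero_mem zero_mem] by simp
  then show ?thesis using T
    by (induction I rule: infinite_finite_induct) (simp_all add: dual_add[OF \<phi>] sum_mem)
qed

text \<open>
  Bounds obtained from \<^const>\<open>form_bounded\<close> concern the unit ball only; they extend by scaling.
\<close>

lemma unit_ball_bound:
  assumes \<phi>: "\<phi> \<in> os_carrier (dual_os V)"
    and C: "\<And>y. y \<in> X \<Longrightarrow> norm y \<le> 1 \<Longrightarrow> cmod (\<phi> y) \<le> C" and y: "y \<in> X"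
  shows "cmod (\<phi> y) \<le> C * norm y"
proof (cases "y = 0")
  case True
  then show ?thesis using dual_add[OF \<phi> zero_mem zero_mem] by simp
next
  case False
  have "\<phi> (op_smul smul (of_real (1 / norm y)) y) = of_real (1 / norm y) * \<phi> y"
    by (rule dual_smul[OF \<phi> y])
  moreover have "cmod (\<phi> ((1 / norm y) *\<^sub>R y)) \<le> C" by (rule C) (simp_all add: scaleR_mem y)
  ultimately have "cmod (of_real (1 / norm y) * \<phi> y) \<le> C" by (simp only: op_smul_of_real)
  then show ?thesis using False by (simp add: norm_mult norm_divide field_simps)
qed

text \<open>
  A functional is completely bounded with its own norm: by linearity the form is the value of \<open>\<phi>\<close> at
  the compression of \<open>y\<close> by the two vectors.
\<close>

lemma functional_form_le:
  assumes \<phi>: "\<phi> \<in> os_carrier (dual_os V)" and c: "\<And>y. y \<in> X \<Longrightarrow> cmod (\<phi> y) \<le> c * norm y" "0 \<le> c"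
    and y: "y \<in> matrices m V"
  shows "cmod (\<Sum>i<m. \<Sum>j<m. b i * \<phi> (y i j) * a j)
    \<le> c * os_norm V m y * (L2_set (\<lambda>j. cmod (a j)) {..<m} * L2_set (\<lambda>i. cmod (b i)) {..<m})"
proof -
  have "\<phi> (\<Sum>i<m. \<Sum>j<m. op_smul smul (b i * a j) (y i j))
      = (\<Sum>i<m. \<Sum>j<m. (b i * a j) * \<phi> (y i j))"
    by (simp add: dual_sum[OF \<phi>] sum_mem smul_mem matrices_mem[OF y] dual_smul[OF \<phi>])
  also have "\<dots> = (\<Sum>i<m. \<Sum>j<m. b i * \<phi> (y i j) * a j)" by (simp add: mult_ac)
  finally show ?thesis
    using order_trans[OF c(1) mult_left_mono[OF norm_compression_le[OF y] c(2)], of b a]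
    by (simp add: sum_mem smul_mem matrices_mem[OF y] mult.assoc)
qed

text \<open>
  A crude bound, by the triangle inequality over the \<open>n\<^sup>2\<close> entries.  It suffices because the entries
  to which it is applied can be made small compared with \<open>1 / n\<^sup>2\<close>.
\<close>

lemma form_bounded_entries:
  assumes F: "\<And>k l. k < n \<Longrightarrow> l < n \<Longrightarrow> F k l \<in> os_carrier (dual_os V)"
    and c: "\<And>k l y. k < n \<Longrightarrow> l < n \<Longrightarrow> y \<in> X \<Longrightarrow> cmod (F k l y) \<le> c * norm y" "0 \<le> c"
  shows "form_bounded V n F (real n ^ 2 * c)"
  unfolding form_bounded_def
proof (intro allI impI)
  fix m y and a b :: "nat \<times> nat \<Rightarrow> complex"
  assume y: "1 \<le> m" "y \<in> matrices m V" "os_norm V m y \<le> 1"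
  let ?A = "L2_set (\<lambda>p. cmod (a p)) ({..<m} \<times> {..<n})"
  let ?B = "L2_set (\<lambda>p. cmod (b p)) ({..<m} \<times> {..<n})"
  have column: "L2_set (\<lambda>i. cmod (a (i, k))) {..<m} \<le> L2_set (\<lambda>p. cmod (a p)) ({..<m} \<times> {..<n})"
    if "k < n" for a :: "nat \<times> nat \<Rightarrow> complex" and k
  proof -
    have "(\<Sum>i<m. (cmod (a (i, k)))\<^sup>2) = (\<Sum>p\<in>(\<lambda>i. (i, k)) ` {..<m}. (cmod (a p))\<^sup>2)"
      by (simp add: sum.reindex inj_on_def)
    also have "\<dots> \<le> (\<Sum>p\<in>{..<m} \<times> {..<n}. (cmod (a p))\<^sup>2)"
      by (rule sum_mono2) (use that in auto)
    finally show ?thesis by (simp add: L2_set_def)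
  qed
  have block: "cmod (\<Sum>i<m. \<Sum>j<m. b (i, k) * F k l (y i j) * a (j, l)) \<le> c * (?A * ?B)"
    if kl: "k < n" "l < n" for k l
  proof -
    have "cmod (\<Sum>i<m. \<Sum>j<m. b (i, k) * F k l (y i j) * a (j, l))
      \<le> c * os_norm V m y * (L2_set (\<lambda>j. cmod (a (j, l))) {..<m} * L2_set (\<lambda>i. cmod (b (i, k))) {..<m})"
      by (rule functional_form_le) (use F c y kl in auto)
    also have "\<dots> \<le> (c * 1) * (?A * ?B)"
      using c(2) y(3) column kl
      by (intro mult_mono mult_left_mono) (auto simp: os_norm_nonneg intro!: mult_nonneg_nonneg)
    finally show ?thesis by simp
  qed
  have "(\<Sum>p\<in>{..<m} \<times> {..<n}. \<Sum>q\<in>{..<m} \<times> {..<n}. b p * F (snd p) (snd q) (y (fst p) (fst q)) * a q)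
      = (\<Sum>i<m. \<Sum>k<n. \<Sum>j<m. \<Sum>l<n. b (i, k) * F k l (y i j) * a (j, l))"
    by (simp add: sum.cartesian_product')
  also have "\<dots> = (\<Sum>k<n. \<Sum>i<m. \<Sum>l<n. \<Sum>j<m. b (i, k) * F k l (y i j) * a (j, l))"
    by (subst sum.swap) (intro sum.cong refl sum.swap)
  also have "\<dots> = (\<Sum>k<n. \<Sum>l<n. \<Sum>i<m. \<Sum>j<m. b (i, k) * F k l (y i j) * a (j, l))"
    by (intro sum.cong refl sum.swap)
  also have "cmod \<dots> \<le> (\<Sum>k<n. \<Sum>l<n. c * (?A * ?B))"
    by (intro sum_norm_le block) auto
  also have "\<dots> = real n ^ 2 * c * (?A * ?B)" by (simp add: power2_eq_square)
  finally show "cmod (\<Sum>p\<in>{..<m} \<times> {..<n}. \<Sum>q\<in>{..<m} \<times> {..<n}.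
      b p * F (snd p) (snd q) (y (fst p) (fst q)) * a q) \<le> real n ^ 2 * c * (?A * ?B)" .
qed

lemma form_bounded_ex:
  assumes F: "\<And>k l. k < n \<Longrightarrow> l < n \<Longrightarrow> F k l \<in> os_carrier (dual_os V)"
  shows "\<exists>C. form_bounded V n F C"
proof -
  have "\<forall>p\<in>{..<n} \<times> {..<n}. \<exists>C. \<forall>y\<in>X. cmod (F (fst p) (snd p) y) \<le> C * norm y"
    using F unfolding dual_carrier_iff by auto
  then obtain C where C: "\<And>p y. p \<in> {..<n} \<times> {..<n} \<Longrightarrow> y \<in> X \<Longrightarrow>
      cmod (F (fst p) (snd p) y) \<le> C p * norm y"
    using bchoice[of "{..<n} \<times> {..<n}" "\<lambda>p C. \<forall>y\<in>X. cmod (F (fst p) (snd p) y) \<le> C * norm y"] by blast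
  define c where "c = (\<Sum>p\<in>{..<n} \<times> {..<n}. \<bar>C p\<bar>)"
  have "cmod (F k l y) \<le> c * norm y" if "k < n" "l < n" "y \<in> X" for k l y
  proof -
    have "C (k, l) \<le> c"
      unfolding c_def using that member_le_sum[of "(k, l)" "{..<n} \<times> {..<n}" "\<lambda>p. \<bar>C p\<bar>"] by auto
    then show ?thesis using C[of "(k, l)" y] that by (fastforce intro: order_trans mult_right_mono)
  qed
  moreover have "0 \<le> c" by (simp add: c_def sum_nonneg)
  ultimately have "form_bounded V n F (real n ^ 2 * c)" by (intro form_bounded_entries F)
  then show ?thesis by blast
qed

lemma os_norm_zero: "os_norm V 1 0 \<le> 1"
  unfolding os_norm_one by simp

lemma form_bounded_vectors:
  assumes F: "form_bounded V n F C" and y: "y \<in> X" "norm y \<le> 1"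
  shows "cmod (\<Sum>k<n. \<Sum>l<n. b k * F k l y * a l)
    \<le> C * (L2_set (\<lambda>l. cmod (a l)) {..<n} * L2_set (\<lambda>k. cmod (b k)) {..<n})"
proof -
  define z where "z = (\<lambda>i j. if i < (1::nat) \<and> j < (1::nat) then y else 0)"
  have z: "z \<in> matrices 1 V" "os_norm V 1 z \<le> 1"
    using y unfolding os_norm_one by (auto simp: z_def matrices_def)
  show ?thesis
    using form_boundedD[OF F order_refl z, of "\<lambda>p. b (snd p)" "\<lambda>p. a (snd p)"]
    unfolding L2_set_def by (simp add: sum.cartesian_product' z_def lessThan_Suc)
qed

lemma form_bounded_entry:
  assumes F: "form_bounded V n F C" and y: "y \<in> X" "norm y \<le> 1" and kl: "k < n" "l < n"
  shows "cmod (F k l y) \<le> C"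
proof -
  define \<delta> :: "nat \<Rightarrow> nat \<Rightarrow> complex" where "\<delta> i j = (if j = i then 1 else 0)" for i j
  have \<delta>: "L2_set (\<lambda>j. cmod (\<delta> i j)) {..<n} = 1" if "i < n" for i
  proof -
    have "(\<Sum>j<n. (cmod (\<delta> i j))\<^sup>2) = (\<Sum>j<n. if j = i then 1 else 0)"
      by (rule sum.cong) (auto simp: \<delta>_def)
    then show ?thesis using that by (simp add: L2_set_def)
  qed
  have "(\<Sum>i<n. \<Sum>j<n. \<delta> k i * F i j y * \<delta> l j) = (\<Sum>i<n. if i = k then F k l y else 0)"
  proof (rule sum.cong[OF refl])
    fix i
    have "(\<Sum>j<n. \<delta> k i * F i j y * \<delta> l j) = (\<Sum>j<n. if j = l then \<delta> k i * F i l y else 0)"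
      by (rule sum.cong) (auto simp: \<delta>_def)
    then show "(\<Sum>j<n. \<delta> k i * F i j y * \<delta> l j) = (if i = k then F k l y else 0)"
      using kl by (simp add: \<delta>_def)
  qed
  then show ?thesis
    using form_bounded_vectors[OF F y, of "\<delta> k" "\<delta> l"] kl \<delta> by simp
qed

end

section \<open>Bi-Lipschitz bounds\<close>

text \<open>
  A bound on the distortion yields constants only up to an arbitrarily small loss, here \<open>1\<close>, since the
  infimum need not be attained.  The Lipschitz constants of the embedding and of its inverse show that
  it is an infimum of a nonempty set.
\<close>

lemma lipschitz_embedding_bounds:
  assumes emb: "lipschitz_embedding A d B e g" and dist: "lipschitz_distortion A d e g \<le> D"
    and d: "\<And>x y. x \<in> A \<Longrightarrow> y \<in> A \<Longrightarrow> 0 \<le> d x y"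
    and e: "\<And>x y. x \<in> A \<Longrightarrow> y \<in> A \<Longrightarrow> 0 \<le> e (g x) (g y)"
  obtains D' r where "0 < D'" "D' < D + 1" "0 < r"
    "\<And>x y. x \<in> A \<Longrightarrow> y \<in> A \<Longrightarrow> r * d x y \<le> e (g x) (g y)"
    "\<And>x y. x \<in> A \<Longrightarrow> y \<in> A \<Longrightarrow> e (g x) (g y) \<le> D' * r * d x y"
proof -
  define S where "S = {D. D > 0 \<and> (\<exists>r>0. \<forall>x\<in>A. \<forall>y\<in>A. r * d x y \<le> e (g x) (g y) \<and> e (g x) (g y) \<le> D * r * d x y)}"
  have "lipschitz_map A d e g" using emb by (simp add: lipschitz_embedding_def)
  then obtain L where L: "\<And>x y. x \<in> A \<Longrightarrow> y \<in> A \<Longrightarrow> e (g x) (g y) \<le> L * d x y"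
    unfolding lipschitz_map_def by blast
  obtain M where M: "\<And>x y. x \<in> A \<Longrightarrow> y \<in> A \<Longrightarrow> d x y \<le> M * e (g x) (g y)"
  proof -
    have "lipschitz_map (g ` A) e d (inv_into A g)" using emb by (simp add: lipschitz_embedding_def)
    then obtain M where "\<forall>u\<in>g ` A. \<forall>v\<in>g ` A. d (inv_into A g u) (inv_into A g v) \<le> M * e u v"
      unfolding lipschitz_map_def by blast
    then have "d (inv_into A g (g x)) (inv_into A g (g y)) \<le> M * e (g x) (g y)"
      if "x \<in> A" "y \<in> A" for x y using that by blast
    moreover have "inj_on g A" using emb by (simp add: lipschitz_embedding_def)
    ultimately show ?thesis by (intro that[of M]) (simp add: inv_into_f_f)
  qed
  define r where "r = 1 / max M 1"
  define E where "E = max L 1 / r"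
  have r: "0 < r" and Er: "E * r = max L 1" and E: "0 < E" by (auto simp: r_def E_def)
  have "r * d x y \<le> e (g x) (g y) \<and> e (g x) (g y) \<le> E * r * d x y"
    if xy: "x \<in> A" "y \<in> A" for x y
  proof
    have "M * e (g x) (g y) \<le> max M 1 * e (g x) (g y)"
      by (rule mult_right_mono[OF _ e[OF xy]]) simp
    then have "d x y \<le> max M 1 * e (g x) (g y)" using M[OF xy] by (rule order_trans[rotated])
    then have "d x y / max M 1 \<le> e (g x) (g y)" by (simp add: pos_divide_le_eq mult.commute)
    then show "r * d x y \<le> e (g x) (g y)" by (simp add: r_def)
    have "L * d x y \<le> max L 1 * d x y" by (rule mult_right_mono[OF _ d[OF xy]]) simp
    then show "e (g x) (g y) \<le> E * r * d x y"
      using L[OF xy] unfolding Er by (rule order_trans[rotated])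
  qed
  then have "E \<in> S" unfolding S_def using r E by blast
  then have "S \<noteq> {}" by blast
  moreover have "Inf S < D + 1" using dist unfolding lipschitz_distortion_def S_def by linarith
  ultimately obtain D' where D': "D' \<in> S" "D' < D + 1" using cInf_lessD by meson
  from D'(1) obtain r' where "0 < D'" "0 < r'"
    and *: "\<forall>x\<in>A. \<forall>y\<in>A. r' * d x y \<le> e (g x) (g y) \<and> e (g x) (g y) \<le> D' * r' * d x y"
    unfolding S_def by blast
  with D'(2) show ?thesis by (intro that[of D' r']) simp_all
qed

lemma lipschitz_embeddingI:
  assumes im: "g ` A \<subseteq> B" and r: "0 < r" and D: "0 < D"
    and sep: "\<And>x y. x \<in> A \<Longrightarrow> y \<in> A \<Longrightarrow> d x y \<le> 0 \<Longrightarrow> x = y"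
    and self: "\<And>x. x \<in> A \<Longrightarrow> d x x = 0"
    and lower: "\<And>x y. x \<in> A \<Longrightarrow> y \<in> A \<Longrightarrow> r * d x y \<le> e (g x) (g y)"
    and upper: "\<And>x y. x \<in> A \<Longrightarrow> y \<in> A \<Longrightarrow> e (g x) (g y) \<le> D * r * d x y"
  shows "lipschitz_embedding A d B e g \<and> lipschitz_distortion A d e g \<le> D"
proof
  have inj: "inj_on g A"
  proof (rule inj_onI)
    fix x y assume xy: "x \<in> A" "y \<in> A" "g x = g y"
    have "r * d x y \<le> e (g x) (g x)" using lower[OF xy(1,2)] xy(3) by simp
    also have "\<dots> \<le> 0" using upper[OF xy(1) xy(1)] self[OF xy(1)] by simp
    finally show "x = y" using r by (intro sep xy) (simp add: mult_le_0_iff)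
  qed
  have "d x y \<le> (1 / r) * e (g x) (g y)" if "x \<in> A" "y \<in> A" for x y
    using lower[OF that] r by (simp add: field_simps)
  then have "lipschitz_map (g ` A) e d (inv_into A g)"
    unfolding lipschitz_map_def by (intro exI[of _ "1 / r"]) (auto simp: inv_into_f_f[OF inj])
  moreover have "lipschitz_map A d e g"
    unfolding lipschitz_map_def using upper by blast
  ultimately show "lipschitz_embedding A d B e g"
    using im inj by (simp add: lipschitz_embedding_def)
  show "lipschitz_distortion A d e g \<le> D"
    unfolding lipschitz_distortion_def
  proof (rule cInf_lower)
    show "D \<in> {D. D > 0 \<and> (\<exists>r>0. \<forall>x\<in>A. \<forall>y\<in>A. r * d x y \<le> e (g x) (g y) \<and> e (g x) (g y) \<le> D * r * d x y)}"
      using r D lower upper by blast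
    show "bdd_below {D. D > 0 \<and> (\<exists>r>0. \<forall>x\<in>A. \<forall>y\<in>A. r * d x y \<le> e (g x) (g y) \<and> e (g x) (g y) \<le> D * r * d x y)}"
      by (rule bdd_belowI[of _ 0]) simp
  qed
qed

section \<open>Near additivity\<close>

locale operator_space_pair =
  X: concrete_operator_space smulH ipH X + Y: concrete_operator_space smulK ipK Y
  for smulH :: "complex \<Rightarrow> 'h::banach \<Rightarrow> 'h" and ipH X
    and smulK :: "complex \<Rightarrow> 'k::banach \<Rightarrow> 'k" and ipK Y
begin

abbreviation dualY where "dualY \<equiv> dual_os Y.V"

lemma dual_amplification_bounded:
  assumes f: "f ` X \<subseteq> os_carrier dualY" and PQ: "P \<in> matrices N X.V" "Q \<in> matrices N X.V"
  shows "form_bounded Y.V N (amplification N f P - amplification N f Q)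
      (os_norm dualY N (amplification N f P - amplification N f Q))"
    and "0 \<le> os_norm dualY N (amplification N f P - amplification N f Q)"
proof -
  have "(amplification N f P - amplification N f Q) k l \<in> os_carrier dualY" for k l
    using f X.matrices_mem PQ Y.dual_zero
    by (auto simp: amplification_def image_subset_iff intro!: Y.dual_diff)
  then obtain C where C: "form_bounded Y.V N (amplification N f P - amplification N f Q) C"
    using Y.form_bounded_ex by blast
  show "form_bounded Y.V N (amplification N f P - amplification N f Q)
      (os_norm dualY N (amplification N f P - amplification N f Q))"
    by (rule form_bounded_dual_norm[OF C])
  show "0 \<le> os_norm dualY N (amplification N f P - amplification N f Q)"
    by (rule dual_norm_nonneg[OF C]) (simp_all add: Y.zero_mem Y.os_norm_zero[simplified])
qed

text \<open>
  The heart of the proof.  Put \<open>a = f (x + v) - f x\<close> and \<open>a' = f (x' + v) - f x'\<close>.  Take the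
  Sylvester matrix \<open>s\<close> of order \<open>N\<close>, and move the entry \<open>(i, j)\<close> from \<open>x\<close> to \<open>x + v\<close> where
  \<open>s i j = 1\<close>, and from \<open>x' + v\<close> to \<open>x'\<close> where \<open>s i j = -1\<close>.  The displacement is \<open>s \<otimes> v\<close>, of norm
  \<open>\<surd>N \<parallel>v\<parallel>\<close>, so the matrix of increments \<open>a\<close> and \<open>-a'\<close> has norm at most \<open>L \<surd>N \<parallel>v\<parallel>\<close>.  But these
  increments are \<open>s i j (a + a') / 2 + (a - a') / 2\<close>, and the constant matrix with entries
  \<open>(a - a') / 2\<close> has norm \<open>N \<parallel>a - a'\<parallel> / 2\<close>, so \<open>a - a'\<close> must be of order \<open>L \<parallel>v\<parallel> / \<surd>N\<close>.
\<close>

lemma almost_additive_unit_ball: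
  fixes k :: nat
  defines "N \<equiv> 2 ^ Suc k"
  assumes f: "f ` X \<subseteq> os_carrier dualY" and L: "0 \<le> L"
    and lip: "\<forall>P\<in>matrices N X.V. \<forall>Q\<in>matrices N X.V.
      os_norm dualY N (amplification N f P - amplification N f Q) \<le> L * os_norm X.V N (P - Q)"
    and x: "x \<in> X" "x' \<in> X" "v \<in> X" and y: "y \<in> Y" "norm y \<le> 1"
  shows "cmod (f (x + v) y - f x y) \<le> L * sqrt N * norm v" (is ?bounded)
    and "cmod ((f (x + v) y - f x y) - (f (x' + v) y - f x' y)) \<le> 4 * L / sqrt N * norm v"
      (is ?almost_additive)
proof -
  define s where "s = sylvester (Suc k)"
  define P where "P i j = (if i < N \<and> j < N then if s i j = 1 then x + v else x' else 0)" for i j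
  define Q where "Q i j = (if i < N \<and> j < N then if s i j = 1 then x else x' + v else 0)" for i j
  define F where "F = amplification N f P - amplification N f Q"
  define a where "a = f (x + v) y - f x y"
  define a' where "a' = f (x' + v) y - f x' y"
  define K where "K = L * (sqrt N * norm v)"
  have N: "real N > 0" by (simp add: N_def)
  have PQ: "P \<in> matrices N X.V" "Q \<in> matrices N X.V"
    using x X.add_mem by (auto simp: matrices_def P_def Q_def)
  have "P - Q = (\<lambda>i j. if i < 2 ^ Suc k \<and> j < 2 ^ Suc k then sylvester (Suc k) i j *\<^sub>R v else 0)"
  proof (intro ext)
    show "(P - Q) i j = (if i < 2 ^ Suc k \<and> j < 2 ^ Suc k then sylvester (Suc k) i j *\<^sub>R v else 0)" for i j
      using sylvester_sign[of "Suc k" i j]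
      by (auto simp: P_def Q_def s_def N_def simp del: sylvester.simps)
  qed
  then have "os_norm X.V N (P - Q) \<le> sqrt N * norm v"
    using X.os_norm_sylvester[of "Suc k" v] by (simp add: N_def del: sylvester.simps power_Suc)
  then have "os_norm dualY N F \<le> K"
    using bspec[OF bspec[OF lip PQ(1)] PQ(2)] L unfolding F_def K_def
    by (meson mult_left_mono order_trans)
  then have F: "form_bounded Y.V N F K"
    using form_bounded_mono dual_amplification_bounded(1)[OF f PQ] unfolding F_def by blast
  have F_y: "F i j y = s i j * ((a + a') / 2) + (a - a') / 2" if "i < N" "j < N" for i j
    using that sylvester_sign[of "Suc k" i j]
    by (auto simp: F_def amplification_def P_def Q_def s_def a_def a'_def field_simps
        simp del: sylvester.simps)
  \<comment> \<open>The signs at \<open>(0, 0)\<close> and \<open>(2 ^ k, 2 ^ k)\<close> are opposite, so both \<open>a\<close> and \<open>a'\<close> occur among the entries.\<close>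
  have corner: "0 < N" "2 ^ k < N" by (simp_all add: N_def)
  have a: "cmod a \<le> K"
    using Y.form_bounded_entry[OF F y corner(1) corner(1)] F_y[OF corner(1) corner(1)]
    by (simp add: s_def sylvester_corner add_divide_distrib[symmetric] del: sylvester.simps)
  have a': "cmod a' \<le> K"
    using Y.form_bounded_entry[OF F y corner(2) corner(2)] F_y[OF corner(2) corner(2)]
      norm_minus_cancel[of a']
    by (simp add: s_def sylvester_neg field_simps del: sylvester.simps)
  show ?bounded using a by (simp add: a_def K_def mult.assoc)
  \<comment> \<open>Test against the constant vectors, where \<open>s\<close> contributes only \<open>N\<close> and the constant part \<open>N\<^sup>2\<close>.\<close>
  have sum_s: "(\<Sum>i<N. \<Sum>j<N. complex_of_real (s i j)) = of_nat N"
  proof -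
    have "(\<Sum>i<N. \<Sum>j<N. s i j) = real N"
      using sum_sylvester[of "Suc k"] by (simp add: s_def N_def del: sylvester.simps)
    then have "complex_of_real (\<Sum>i<N. \<Sum>j<N. s i j) = of_nat N" by simp
    then show ?thesis by simp
  qed
  have "(\<Sum>i<N. \<Sum>j<N. F i j y) = (\<Sum>i<N. \<Sum>j<N. s i j * ((a + a') / 2) + (a - a') / 2)"
    by (simp add: F_y)
  also have "\<dots> = of_nat N * ((a + a') / 2) + of_nat N * of_nat N * ((a - a') / 2)"
    unfolding sum.distrib sum_distrib_right[symmetric] sum_s by simp
  finally have total: "(\<Sum>i<N. \<Sum>j<N. F i j y)
      = of_nat N * ((a + a') / 2) + of_nat N * of_nat N * ((a - a') / 2)" .
  have "cmod (\<Sum>i<N. \<Sum>j<N. F i j y) \<le> K * N"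
    using Y.form_bounded_vectors[OF F y, of "\<lambda>_. 1" "\<lambda>_. 1"] by (simp add: L2_set_constant)
  moreover have "cmod (of_nat N * ((a + a') / 2)) \<le> N * K"
  proof -
    have "cmod ((a + a') / 2) \<le> K" using a a' norm_triangle_ineq[of a a'] by (simp add: norm_divide)
    then show ?thesis by (simp add: norm_mult mult_left_mono del: times_divide_eq_right)
  qed
  moreover have "cmod (of_nat N * of_nat N * ((a - a') / 2))
      \<le> cmod (\<Sum>i<N. \<Sum>j<N. F i j y) + cmod (of_nat N * ((a + a') / 2))"
    using norm_triangle_ineq4[of "\<Sum>i<N. \<Sum>j<N. F i j y" "of_nat N * ((a + a') / 2)"]
    unfolding total by simp
  ultimately have "N * (N * (cmod (a - a') / 2)) \<le> N * (2 * K)"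
    by (simp add: norm_mult norm_divide mult_ac)
  then have "N * cmod (a - a') \<le> 4 * K" using N by simp
  then have "cmod (a - a') \<le> 4 * K / N" using N by (simp add: field_simps)
  also have "\<dots> = 4 * L * norm v * (sqrt N / N)" by (simp add: K_def)
  also have "sqrt N / N = 1 / sqrt N" using N by (simp add: real_div_sqrt divide_eq_eq)
  finally show ?almost_additive by (simp add: a_def a'_def mult.commute)
qed

lemma almost_additive:
  fixes k :: nat
  defines "N \<equiv> 2 ^ Suc k"
  assumes f: "f ` X \<subseteq> os_carrier dualY" and L: "0 \<le> L"
    and lip: "\<forall>P\<in>matrices N X.V. \<forall>Q\<in>matrices N X.V.
      os_norm dualY N (amplification N f P - amplification N f Q) \<le> L * os_norm X.V N (P - Q)"
    and x: "x \<in> X" "x' \<in> X" "v \<in> X" and y: "y \<in> Y"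
  shows "cmod (f (x + v) y - f x y) \<le> L * sqrt N * norm v * norm y"
    and "cmod ((f (x + v) y - f x y) - (f (x' + v) y - f x' y)) \<le> 4 * L / sqrt N * norm v * norm y"
proof -
  have d: "f (x + v) - f x \<in> os_carrier dualY" "f (x' + v) - f x' \<in> os_carrier dualY"
    using f x X.add_mem by (auto simp: image_subset_iff intro!: Y.dual_diff)
  note unit = almost_additive_unit_ball[where k = k and f = f and L = L, folded N_def, OF f L lip x]
  show "cmod (f (x + v) y - f x y) \<le> L * sqrt N * norm v * norm y"
    using Y.unit_ball_bound[OF d(1) _ y, of "L * sqrt N * norm v"] unit(1) by simp
  show "cmod ((f (x + v) y - f x y) - (f (x' + v) y - f x' y)) \<le> 4 * L / sqrt N * norm v * norm y"
    using Y.unit_ball_bound[OF Y.dual_diff[OF d] _ y, of "4 * L / sqrt N * norm v"] unit(2) by simp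
qed

section \<open>Linearization by averaging\<close>

text \<open>
  The mean over all base points \<open>x \<in> X\<close> of \<open>f (x + v) - f x\<close> is additive in \<open>v\<close>, by invariance, and
  stays within the near-additivity error of its value at \<open>x = 0\<close>.  The limit of
  \<open>f (2 ^ i v) / 2 ^ i\<close> would not serve: the error is of the first order in \<open>v\<close>, so the bounds on
  the differences of consecutive terms do not decay.  Averaging the values at each \<open>y\<close> keeps the result inside the dual space.
\<close>

lemma linearization:
  fixes k :: nat
  defines "N \<equiv> 2 ^ Suc k"
  assumes f: "f ` X \<subseteq> os_carrier dualY" and L: "0 \<le> L"
    and lip: "\<forall>P\<in>matrices N X.V. \<forall>Q\<in>matrices N X.V.
      os_norm dualY N (amplification N f P - amplification N f Q) \<le> L * os_norm X.V N (P - Q)"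
  obtains g where "\<And>v. v \<in> X \<Longrightarrow> g v \<in> os_carrier dualY"
    "\<And>u v. u \<in> X \<Longrightarrow> v \<in> X \<Longrightarrow> g (u + v) = g u + g v"
    "\<And>v t y. v \<in> X \<Longrightarrow> g (t *\<^sub>R v) y = of_real t * g v y"
    "\<And>v y. v \<in> X \<Longrightarrow> y \<in> Y \<Longrightarrow>
       cmod (g v y - (f v y - f 0 y)) \<le> 4 * L / sqrt N * norm v * norm y"
proof -
  have fX: "f x \<in> os_carrier dualY" if "x \<in> X" for x using f that by blast
  obtain m :: "(('h \<Rightarrow>\<^sub>L 'h) \<Rightarrow> complex) \<Rightarrow> complex" where
    m_add: "\<And>h h' C C'. (\<And>x. x \<in> X \<Longrightarrow> cmod (h x) \<le> C) \<Longrightarrow> (\<And>x. x \<in> X \<Longrightarrow> cmod (h' x) \<le> C') \<Longrightarrow>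
       m (\<lambda>x. h x + h' x) = m h + m h'"
    and m_scale: "\<And>h c C. (\<And>x. x \<in> X \<Longrightarrow> cmod (h x) \<le> C) \<Longrightarrow> m (\<lambda>x. c * h x) = c * m h"
    and m_le: "\<And>h C. (\<And>x. x \<in> X \<Longrightarrow> cmod (h x) \<le> C) \<Longrightarrow> cmod (m h) \<le> C"
    and m_shift: "\<And>h t C. (\<And>x. x \<in> X \<Longrightarrow> cmod (h x) \<le> C) \<Longrightarrow> t \<in> X \<Longrightarrow> m (\<lambda>x. h (x + t)) = m h"
    and m_const: "\<And>c. m (\<lambda>x. c) = c"
    by (rule invariant_mean_complex[of X, OF X.zero_mem X.add_mem]) blast+
  have m_cong: "m h = m h'" if h: "\<And>x. x \<in> X \<Longrightarrow> h x = h' x" and C: "\<And>x. x \<in> X \<Longrightarrow> cmod (h x) \<le> C" for h h' C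
  proof -
    have "m (\<lambda>x. (h x - h' x) + h' x) = m (\<lambda>x. h x - h' x) + m h'"
      by (rule m_add[of _ 0 _ C]) (use h C in fastforce)+
    moreover have "cmod (m (\<lambda>x. h x - h' x)) \<le> 0" by (rule m_le) (simp add: h)
    ultimately show ?thesis by simp
  qed
  define \<Delta> where "\<Delta> v y x = f (x + v) y - f x y" for v y x
  define g where "g v y = (if y \<in> Y then m (\<Delta> v y) else 0)" for v y
  define B where "B v y = L * sqrt N * norm v * norm y" for v :: "'h \<Rightarrow>\<^sub>L 'h" and y :: "'k \<Rightarrow>\<^sub>L 'k"
  note almost = almost_additive[where k = k and f = f and L = L, folded N_def, OF f L lip]
  have bound: "cmod (\<Delta> v y x) \<le> B v y" if "v \<in> X" "y \<in> Y" "x \<in> X" for v y x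
    unfolding \<Delta>_def B_def using almost(1)[OF that(3) X.zero_mem that(1,2)] by simp
  have g_bound: "cmod (g v y) \<le> B v y" if "v \<in> X" "y \<in> Y" for v y
    using m_le[of "\<Delta> v y" "B v y"] bound that by (simp add: g_def)
  have g_dual: "g v \<in> os_carrier dualY" if v: "v \<in> X" for v
    unfolding Y.dual_carrier_iff
  proof (intro conjI ballI allI impI)
    fix y z assume yz: "y \<in> Y" "z \<in> Y"
    have "m (\<Delta> v (y + z)) = m (\<lambda>x. \<Delta> v y x + \<Delta> v z x)"
    proof (rule m_cong[where C = "B v (y + z)"])
      show "\<Delta> v (y + z) x = \<Delta> v y x + \<Delta> v z x" if "x \<in> X" for x
        using Y.dual_add[OF fX yz] that v X.add_mem by (simp add: \<Delta>_def)
    qed (use bound v yz Y.add_mem in blast)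
    also have "\<dots> = m (\<Delta> v y) + m (\<Delta> v z)"
      by (rule m_add[of _ "B v y" _ "B v z"]) (use bound v yz in blast)+
    finally show "g v (y + z) = g v y + g v z" using yz Y.add_mem by (simp add: g_def)
  next
    fix a y assume y: "y \<in> Y"
    have "m (\<Delta> v (op_smul smulK a y)) = m (\<lambda>x. a * \<Delta> v y x)"
    proof (rule m_cong[where C = "B v (op_smul smulK a y)"])
      show "\<Delta> v (op_smul smulK a y) x = a * \<Delta> v y x" if "x \<in> X" for x
        using Y.dual_smul[OF fX y] that v X.add_mem by (simp add: \<Delta>_def right_diff_distrib)
    qed (use bound v y Y.smul_mem in blast)
    also have "\<dots> = a * m (\<Delta> v y)"
      by (rule m_scale[of _ "B v y"]) (use bound v y in blast)
    finally show "g v (op_smul smulK a y) = a * g v y" using y Y.smul_mem by (simp add: g_def)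
  next
    show "\<exists>C. \<forall>y\<in>Y. cmod (g v y) \<le> C * norm y"
      using g_bound[OF v] unfolding B_def by blast
  qed (simp add: g_def)
  have g_add: "g (u + v) = g u + g v" if u: "u \<in> X" and v: "v \<in> X" for u v
  proof
    fix y
    show "g (u + v) y = (g u + g v) y"
    proof (cases "y \<in> Y")
      case True
      \<comment> \<open>The increment along \<open>u + v\<close> goes through \<open>x + u\<close>; the mean does not see that shift.\<close>
      have "m (\<Delta> (u + v) y) = m (\<lambda>x. \<Delta> v y (x + u) + \<Delta> u y x)"
        by (rule m_cong[where C = "B (u + v) y"])
          (use bound u v True X.add_mem in \<open>auto simp: \<Delta>_def add.assoc\<close>)
      also have "\<dots> = m (\<lambda>x. \<Delta> v y (x + u)) + m (\<Delta> u y)"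
        by (rule m_add[of _ "B v y" _ "B u y"]) (use bound u v True X.add_mem in blast)+
      also have "m (\<lambda>x. \<Delta> v y (x + u)) = m (\<Delta> v y)"
        by (rule m_shift[of _ "B v y", OF _ u]) (use bound v True in blast)
      finally show ?thesis using True by (simp add: g_def)
    qed (simp add: g_def)
  qed
  have g_scale: "g (t *\<^sub>R v) y = of_real t * g v y" if v: "v \<in> X" for v t y
  proof (cases "y \<in> Y")
    case True
    have "g (t *\<^sub>R v) y = t *\<^sub>R g (1 *\<^sub>R v) y"
    proof (rule additive_lipschitz_real_linear[where C = "B v y"])
      show "g ((s + t) *\<^sub>R v) y = g (s *\<^sub>R v) y + g (t *\<^sub>R v) y" for s t
        using g_add[of "s *\<^sub>R v" "t *\<^sub>R v"] X.scaleR_mem[OF v] by (simp add: scaleR_left_distrib)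
      show "cmod (g (t *\<^sub>R v) y) \<le> B v y * \<bar>t\<bar>" for t
        using g_bound[OF X.scaleR_mem[OF v] True, of t] by (simp add: B_def mult_ac)
    qed
    then show ?thesis by (simp add: scaleR_conv_of_real)
  qed (simp add: g_def)
  have "cmod (g v y - (f v y - f 0 y)) \<le> 4 * L / sqrt N * norm v * norm y" if v: "v \<in> X" and y: "y \<in> Y" for v y
  proof -
    have "m (\<Delta> v y) = m (\<lambda>x. (\<Delta> v y x - \<Delta> v y 0) + \<Delta> v y 0)" by (rule arg_cong[of _ _ m]) auto
    also have "\<dots> = m (\<lambda>x. \<Delta> v y x - \<Delta> v y 0) + \<Delta> v y 0"
      using almost(2)[OF _ X.zero_mem v y]
      by (subst m_add[of _ "4 * L / sqrt N * norm v * norm y" _ "cmod (\<Delta> v y 0)"])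
        (simp_all add: \<Delta>_def m_const)
    finally have "g v y - (f v y - f 0 y) = m (\<lambda>x. \<Delta> v y x - \<Delta> v y 0)"
      using y by (simp add: g_def \<Delta>_def)
    also have "cmod \<dots> \<le> 4 * L / sqrt N * norm v * norm y"
      by (rule m_le) (use almost(2)[OF _ X.zero_mem v y] in \<open>simp add: \<Delta>_def\<close>)
    finally show ?thesis .
  qed
  then show ?thesis using g_dual g_add g_scale that by blast
qed

section \<open>Complex-linear embeddings\<close>

sublocale Yc: concrete_operator_space "conj_smul smulK" "\<lambda>x y. ipK y x" Y
proof -
  interpret c: complex_hilbert_space "conj_smul smulK" "\<lambda>x y. ipK y x"
    by (rule complex_hilbert_space_conj[OF Y.complex_hilbert_space_axioms])
  show "concrete_operator_space (conj_smul smulK) (\<lambda>x y. ipK y x) Y"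
    by unfold_locales (rule operator_space_conj[OF Y.complex_hilbert_space_axioms Y.operator_space])
qed

lemma form_bounded_conj: "form_bounded Yc.V n F C \<longleftrightarrow> form_bounded Y.V n F C"
  by (simp add: form_bounded_def matrices_def concrete_os_def)

text \<open>
  Conjugation of values identifies functionals on \<open>Y\<close> with functionals on its conjugate.  The norms
  agree because the underlying operators do.
\<close>

lemma cnj_dual:
  assumes "\<phi> \<in> os_carrier dualY"
  shows "(\<lambda>y. cnj (\<phi> y)) \<in> os_carrier (dual_os Yc.V)"
  using assms unfolding Y.dual_carrier_iff Yc.dual_carrier_iff by (simp add: op_smul_conj)

abbreviation \<J> where "\<J> \<equiv> op_smul smulH \<i>"

lemma op_smul_decompose: "op_smul smulH a x = Re a *\<^sub>R x + Im a *\<^sub>R \<J> x"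
proof (rule blinfun_eqI)
  fix \<xi>
  have "smulH a \<eta> = smulH (of_real (Re a) + of_real (Im a) * \<i>) \<eta>" for \<eta>
    by (rule arg_cong[of _ _ "\<lambda>a. smulH a \<eta>"]) (simp add: complex_eq_iff)
  then have "smulH a \<eta> = Re a *\<^sub>R \<eta> + Im a *\<^sub>R smulH \<i> \<eta>" for \<eta>
    by (simp add: X.scale_left_distrib X.smul_of_real X.scale_scale[symmetric] del: X.scale_scale)
  then show "blinfun_apply (op_smul smulH a x) \<xi> = blinfun_apply (Re a *\<^sub>R x + Im a *\<^sub>R \<J> x) \<xi>"
    by (simp add: blinfun.add_left blinfun.scaleR_left)
qed

text \<open>
  A real-linear \<open>g\<close> is the sum of its complex-linear part \<open>(g v - i g (i v)) / 2\<close> and its antilinear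
  part \<open>(g v + i g (i v)) / 2\<close>.  The conjugate of the second is a complex-linear map into the dual of
  the conjugate space, which is why that summand appears.
\<close>

lemma complexification:
  assumes g_dual: "\<And>v. v \<in> X \<Longrightarrow> g v \<in> os_carrier dualY"
    and g_add: "\<And>u v. u \<in> X \<Longrightarrow> v \<in> X \<Longrightarrow> g (u + v) = g u + g v"
    and g_scale: "\<And>v t y. v \<in> X \<Longrightarrow> g (t *\<^sub>R v) y = of_real t * g v y"
  defines "h \<equiv> \<lambda>v. (\<lambda>y. 1 / 2 * g v y + - \<i> / 2 * g (\<J> v) y,
                     \<lambda>y. cnj (1 / 2 * g v y + \<i> / 2 * g (\<J> v) y))"
  shows "h ` X \<subseteq> os_carrier (direct_sum_os dualY (dual_os Yc.V))"
    and "clinear_on X (op_smul smulH) (os_smul (direct_sum_os dualY (dual_os Yc.V))) h"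
proof -
  have J: "\<J> v \<in> X" if "v \<in> X" for v using that by (rule X.smul_mem)
  show "h ` X \<subseteq> os_carrier (direct_sum_os dualY (dual_os Yc.V))"
  proof
    fix z assume "z \<in> h ` X"
    then obtain v where v: "v \<in> X" "z = h v" by blast
    show "z \<in> os_carrier (direct_sum_os dualY (dual_os Yc.V))"
      unfolding v(2) h_def direct_sum_os_def matrix_normed.simps mem_Times_iff fst_conv snd_conv
      by (intro conjI cnj_dual Y.dual_lin_comb g_dual J v(1))
  qed
  have g_smul: "g (op_smul smulH a v) y = Re a * g v y + Im a * g (\<J> v) y" if "v \<in> X" for a v y
    unfolding op_smul_decompose[of a v]
    by (simp add: g_add g_scale X.scaleR_mem J that)
  have J_add: "\<J> (u + v) = \<J> u + \<J> v" for u v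
    by (rule blinfun_eqI) (simp add: blinfun.add_left X.scale_right_distrib)
  have J_smul: "\<J> (op_smul smulH a v) = op_smul smulH (\<i> * a) v" for a v
    by (rule blinfun_eqI) simp
  have "h (u + v) = h u + h v" if uv: "u \<in> X" "v \<in> X" for u v
  proof -
    have g_uv: "g (u + v) = g u + g v" "g (\<J> (u + v)) = g (\<J> u) + g (\<J> v)"
      unfolding J_add by (intro g_add J uv)+
    have split: "1 / 2 * (s + t) + c / 2 * (s' + t') = (1 / 2 * s + c / 2 * s') + (1 / 2 * t + c / 2 * t')"
      for s t s' t' c :: complex
      by (simp add: distrib_left add_divide_distrib)
    show ?thesis
    proof (rule prod_eqI; rule ext)
      show "fst (h (u + v)) y = fst (h u + h v) y" for y
        unfolding h_def fst_add fst_conv plus_fun_apply g_uv by (rule split)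
      show "snd (h (u + v)) y = snd (h u + h v) y" for y
        unfolding h_def snd_add snd_conv plus_fun_apply g_uv split by (rule complex_cnj_add)
    qed
  qed
  moreover have "h (op_smul smulH a v) = os_smul (direct_sum_os dualY (dual_os Yc.V)) a (h v)"
    if v: "v \<in> X" for a v
  proof -
    \<comment> \<open>Both parts at \<open>a v\<close> are computed from \<open>G = g v y\<close> and \<open>H = g (i v) y\<close>.\<close>
    have Complex: "Complex p q = of_real p + \<i> * of_real q" for p q by (simp add: complex_eq_iff)
    have commute: "complex_of_real t * (\<i> * z) = \<i> * (complex_of_real t * z)" for t z
      by (rule mult.left_commute)
    have "1 / 2 * (of_real p * G + of_real q * H) + - \<i> / 2 * (of_real (- q) * G + of_real p * H)
        = Complex p q * (1 / 2 * G + - \<i> / 2 * H)" for p q and G H :: complex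
      unfolding Complex
      by (simp add: ring_distribs add_divide_distrib diff_divide_distrib mult.assoc commute)
    then have linear_part: "1 / 2 * (of_real (Re a) * G + of_real (Im a) * H)
          + - \<i> / 2 * (of_real (- Im a) * G + of_real (Re a) * H)
        = a * (1 / 2 * G + - \<i> / 2 * H)" for G H
      by (metis complex_surj)
    have antilinear_part: "cnj (1 / 2 * (of_real (Re a) * G + of_real (Im a) * H)
          + \<i> / 2 * (of_real (- Im a) * G + of_real (Re a) * H))
        = a * cnj (1 / 2 * G + \<i> / 2 * H)" for G H
      using linear_part[of "cnj G" "cnj H"] by simp
    have "Re (\<i> * a) = - Im a" "Im (\<i> * a) = Re a" by simp_all
    note parts = this linear_part antilinear_part
    show ?thesis
      unfolding h_def direct_sum_os_def dual_os_def matrix_normed.simps prod.case J_smul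
        g_smul[OF v, of a] g_smul[OF v, of "\<i> * a"]
      by (simp only: parts)
  qed
  ultimately show "clinear_on X (op_smul smulH) (os_smul (direct_sum_os dualY (dual_os Yc.V))) h"
    by (simp add: clinear_on_def)
qed

text \<open>
  On \<open>n \<times> n\<close> matrices the linearization \<open>g\<close> of \<open>f\<close> differs from \<open>f - f 0\<close> by at most half of the
  lower Lipschitz constant, so its amplification is still bounded below by \<open>r / 2\<close>.  Since \<open>g\<close> is the
  sum of its two parts, one of the parts keeps at least \<open>r / 4\<close>.  Multiplication by \<open>i\<close> being
  isometric on matrices, the upper bound for \<open>g\<close> passes to both parts.
\<close>

lemma linear_approximant:
  fixes k n :: nat
  defines "N \<equiv> 2 ^ Suc k"
  assumes n: "n \<le> N" and f: "f ` X \<subseteq> os_carrier dualY" and r: "0 < r" and L: "0 \<le> L"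
    and lower: "\<forall>P\<in>matrices N X.V. \<forall>Q\<in>matrices N X.V.
      r * os_norm X.V N (P - Q) \<le> os_norm dualY N (amplification N f P - amplification N f Q)"
    and upper: "\<forall>P\<in>matrices N X.V. \<forall>Q\<in>matrices N X.V.
      os_norm dualY N (amplification N f P - amplification N f Q) \<le> L * os_norm X.V N (P - Q)"
    and small: "real n ^ 2 * (4 * L / sqrt N) \<le> r / 2"
  obtains h where "h ` X \<subseteq> os_carrier (direct_sum_os dualY (dual_os Yc.V))"
    "clinear_on X (op_smul smulH) (os_smul (direct_sum_os dualY (dual_os Yc.V))) h"
    "\<And>M. M \<in> matrices n X.V \<Longrightarrow> r / 4 * os_norm X.V n M
       \<le> os_norm (direct_sum_os dualY (dual_os Yc.V)) n (amplification n h M)"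
    "\<And>M. M \<in> matrices n X.V \<Longrightarrow> os_norm (direct_sum_os dualY (dual_os Yc.V)) n (amplification n h M)
       \<le> (L + r / 2) * os_norm X.V n M"
proof -
  obtain g where g_dual: "\<And>v. v \<in> X \<Longrightarrow> g v \<in> os_carrier dualY"
    and g_add: "\<And>u v. u \<in> X \<Longrightarrow> v \<in> X \<Longrightarrow> g (u + v) = g u + g v"
    and g_scale: "\<And>v t y. v \<in> X \<Longrightarrow> g (t *\<^sub>R v) y = of_real t * g v y"
    and g_near: "\<And>v y. v \<in> X \<Longrightarrow> y \<in> Y \<Longrightarrow>
       cmod (g v y - (f v y - f 0 y)) \<le> 4 * L / sqrt N * norm v * norm y"
    using linearization[where k = k and f = f and L = L, folded N_def, OF f L upper] by blast
  define g1 where "g1 v = (\<lambda>y. 1 / 2 * g v y + - \<i> / 2 * g (\<J> v) y)" for v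
  define g2 where "g2 v = (\<lambda>y. cnj (1 / 2 * g v y + \<i> / 2 * g (\<J> v) y))" for v
  define h where "h v = (g1 v, g2 v)" for v
  let ?Z = "direct_sum_os dualY (dual_os Yc.V)"
  have h: "h ` X \<subseteq> os_carrier ?Z" "clinear_on X (op_smul smulH) (os_smul ?Z) h"
    using complexification[of g, OF g_dual g_add g_scale] unfolding h_def[abs_def] g1_def g2_def by blast+
  have norm_h: "os_norm ?Z n (amplification n h M)
      = max (os_norm dualY n (amplification n g1 M)) (os_norm (dual_os Yc.V) n (amplification n g2 M))" for M
  proof -
    have "(\<lambda>i j. fst (amplification n h M i j)) = amplification n g1 M"
      "(\<lambda>i j. snd (amplification n h M i j)) = amplification n g2 M"
      by (auto simp: amplification_def h_def fun_eq_iff)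
    then show ?thesis by (simp add: direct_sum_os_def)
  qed
  have fX: "f x \<in> os_carrier dualY" if "x \<in> X" for x using f that by blast
  define \<eta> where "\<eta> = 4 * L / sqrt N"
  have \<eta>: "0 \<le> \<eta>" by (simp add: \<eta>_def L)
  define F where "F M = amplification n f M - amplification n f 0" for M
  have F_N: "F M = amplification N f M - amplification N f 0" if "M \<in> matrices n X.V" for M
    using n that by (auto simp: F_def amplification_def matrices_def fun_eq_iff)
  have matrix_N: "M \<in> matrices N X.V" if "M \<in> matrices n X.V" for M
    using n that X.zero_mem X.matrices_mem[OF that] by (auto simp: matrices_def)
  have F_norm: "r * os_norm X.V n M \<le> os_norm dualY n (F M)" "os_norm dualY n (F M) \<le> L * os_norm X.V n M"
    if M: "M \<in> matrices n X.V" for M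
  proof -
    have "os_norm dualY N (F M) = os_norm dualY n (F M)"
      by (rule dual_norm_restrict[OF n]) (auto simp: F_def amplification_def)
    then show "r * os_norm X.V n M \<le> os_norm dualY n (F M)" "os_norm dualY n (F M) \<le> L * os_norm X.V n M"
      using bspec[OF bspec[OF lower matrix_N[OF M]] X.zero_matrix]
        bspec[OF bspec[OF upper matrix_N[OF M]] X.zero_matrix] X.os_norm_restrict[OF M n]
      unfolding F_N[OF M] by simp_all
  qed
  have error: "form_bounded Y.V n (amplification n g M - F M) (r / 2 * os_norm X.V n M)"
    if M: "M \<in> matrices n X.V" for M
  proof -
    have "form_bounded Y.V n (amplification n g M - F M) (real n ^ 2 * (\<eta> * os_norm X.V n M))"
    proof (rule Y.form_bounded_entries)
      fix k l assume kl: "k < n" "l < n"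
      have eq: "(amplification n g M - F M) k l = g (M k l) - (f (M k l) - f 0)"
        using kl by (simp add: amplification_def F_def)
      show "(amplification n g M - F M) k l \<in> os_carrier dualY"
        unfolding eq by (intro Y.dual_diff g_dual fX X.zero_mem X.matrices_mem[OF M])
      fix y assume y: "y \<in> Y"
      have "cmod ((amplification n g M - F M) k l y) \<le> \<eta> * norm (M k l) * norm y"
        unfolding eq using g_near[OF X.matrices_mem[OF M] y, of k l] by (simp add: \<eta>_def)
      also have "\<dots> \<le> \<eta> * os_norm X.V n M * norm y"
        by (intro mult_right_mono mult_left_mono X.os_norm_entry kl \<eta>) simp
      finally show "cmod ((amplification n g M - F M) k l y) \<le> \<eta> * os_norm X.V n M * norm y" .
    qed (simp add: \<eta> X.os_norm_nonneg)
    moreover have "real n ^ 2 * (\<eta> * os_norm X.V n M) \<le> r / 2 * os_norm X.V n M"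
      using mult_right_mono[OF small X.os_norm_nonneg] by (simp add: \<eta>_def mult.assoc)
    ultimately show ?thesis by (rule form_bounded_mono)
  qed
  have F_bounded: "form_bounded Y.V n (F M) (os_norm dualY n (F M))" if "M \<in> matrices n X.V" for M
    unfolding F_def by (rule dual_amplification_bounded(1)[OF f that X.zero_matrix])
  have g_bounded: "form_bounded Y.V n (amplification n g M) ((L + r / 2) * os_norm X.V n M)"
    if M: "M \<in> matrices n X.V" for M
  proof -
    have "form_bounded Y.V n (\<lambda>k l y. (amplification n g M - F M) k l y + F M k l y)
        (r / 2 * os_norm X.V n M + L * os_norm X.V n M)"
      by (rule form_bounded_add[OF error[OF M] form_bounded_mono[OF F_bounded[OF M] F_norm(2)[OF M]]])
    then show ?thesis by (simp add: algebra_simps)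
  qed
  define JM where "JM M = (\<lambda>i j. \<J> (M i j))" for M :: "nat \<Rightarrow> nat \<Rightarrow> 'h \<Rightarrow>\<^sub>L 'h"
  have J_0: "\<J> 0 = 0" by (rule blinfun_eqI) simp
  have JM: "JM M \<in> matrices n X.V" "os_norm X.V n (JM M) \<le> os_norm X.V n M"
    if M: "M \<in> matrices n X.V" for M
    using M X.smul_mem J_0 X.os_norm_smul[OF M, of \<i>] by (auto simp: JM_def matrices_def)
  have combination: "form_bounded Y.V n
      (\<lambda>k l y. 1 / 2 * amplification n g M k l y + c / 2 * amplification n g (JM M) k l y)
      ((L + r / 2) * os_norm X.V n M)"
    if M: "M \<in> matrices n X.V" and c: "cmod c = 1" for M c
  proof -
    have "(L + r / 2) * os_norm X.V n (JM M) \<le> (L + r / 2) * os_norm X.V n M"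
      using JM(2)[OF M] L r by (intro mult_left_mono) auto
    then have "form_bounded Y.V n (amplification n g (JM M)) ((L + r / 2) * os_norm X.V n M)"
      using g_bounded[OF JM(1)[OF M]] by (rule form_bounded_mono[rotated])
    from form_bounded_add[OF form_bounded_scale[OF g_bounded[OF M], of "1 / 2"]
        form_bounded_scale[OF this, of "c / 2"]]
    show ?thesis using c by (simp add: norm_divide mult.commute)
  qed
  have g1_eq: "amplification n g1 M
      = (\<lambda>k l y. 1 / 2 * amplification n g M k l y + - \<i> / 2 * amplification n g (JM M) k l y)" for M
    by (auto simp: amplification_def g1_def JM_def fun_eq_iff)
  have g2_eq: "amplification n g2 M
      = (\<lambda>k l y. cnj (1 / 2 * amplification n g M k l y + \<i> / 2 * amplification n g (JM M) k l y))" for M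
    by (auto simp: amplification_def g2_def JM_def fun_eq_iff)
  have g1: "form_bounded Y.V n (amplification n g1 M) ((L + r / 2) * os_norm X.V n M)"
    and g2: "form_bounded Yc.V n (amplification n g2 M) ((L + r / 2) * os_norm X.V n M)"
    if M: "M \<in> matrices n X.V" for M
    unfolding g1_eq g2_eq form_bounded_conj
    using combination[OF M, of "- \<i>"] form_bounded_cnj[OF combination[OF M, of "\<i>"]] by simp_all
  have "os_norm ?Z n (amplification n h M) \<le> (L + r / 2) * os_norm X.V n M"
    if M: "M \<in> matrices n X.V" for M
  proof -
    have C: "0 \<le> (L + r / 2) * os_norm X.V n M" using L r X.os_norm_nonneg by simp
    have "os_norm dualY n (amplification n g1 M) \<le> (L + r / 2) * os_norm X.V n M"
      by (rule dual_norm_le[OF g1[OF M] C _ Y.os_norm_zero]) (simp add: Y.zero_mem)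
    moreover have "os_norm (dual_os Yc.V) n (amplification n g2 M) \<le> (L + r / 2) * os_norm X.V n M"
      by (rule dual_norm_le[OF g2[OF M] C _ Yc.os_norm_zero]) (simp add: Y.zero_mem)
    ultimately show ?thesis by (simp add: norm_h)
  qed
  moreover have "r / 4 * os_norm X.V n M \<le> os_norm ?Z n (amplification n h M)"
    if M: "M \<in> matrices n X.V" for M
  proof -
    define K where "K = os_norm ?Z n (amplification n h M)"
    have K1: "form_bounded Y.V n (amplification n g1 M) K"
      by (rule form_bounded_mono[OF form_bounded_dual_norm[OF g1[OF M]]]) (simp add: K_def norm_h)
    have "form_bounded Yc.V n (amplification n g2 M) K"
      by (rule form_bounded_mono[OF form_bounded_dual_norm[OF g2[OF M]]]) (simp add: K_def norm_h)
    then have K2: "form_bounded Y.V n (\<lambda>k l y. cnj (amplification n g2 M k l y)) K"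
      unfolding form_bounded_conj by (rule form_bounded_cnj)
    have "form_bounded Y.V n (\<lambda>k l y. (amplification n g1 M k l y + cnj (amplification n g2 M k l y))
        + -1 * (amplification n g M - F M) k l y) (K + K + cmod (-1) * (r / 2 * os_norm X.V n M))"
      by (intro form_bounded_add K1 K2 form_bounded_scale error M)
    moreover have "(\<lambda>k l y. (amplification n g1 M k l y + cnj (amplification n g2 M k l y))
        + -1 * (amplification n g M - F M) k l y) = F M"
      by (simp add: g1_eq g2_eq fun_eq_iff)
    ultimately have *: "form_bounded Y.V n (F M) (2 * K + r / 2 * os_norm X.V n M)" by simp
    have "0 \<le> os_norm dualY n (amplification n g1 M)"
      by (rule dual_norm_nonneg[OF g1[OF M] _ Y.os_norm_zero]) (simp add: Y.zero_mem)
    then have "0 \<le> K" by (simp add: K_def norm_h)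
    then have "os_norm dualY n (F M) \<le> 2 * K + r / 2 * os_norm X.V n M"
      using r X.os_norm_nonneg by (intro dual_norm_le[OF * _ _ Y.os_norm_zero]) (simp_all add: Y.zero_mem)
    then show ?thesis using F_norm(1)[OF M] by (simp add: K_def)
  qed
  ultimately show ?thesis using h that by blast
qed

end

theorem corollary1p7:
  fixes smulH :: "complex \<Rightarrow> 'h::banach \<Rightarrow> 'h" and ipH :: "'h \<Rightarrow> 'h \<Rightarrow> complex"
    and smulK :: "complex \<Rightarrow> 'k::banach \<Rightarrow> 'k" and ipK :: "'k \<Rightarrow> 'k \<Rightarrow> complex"
    and X :: "('h \<Rightarrow>\<^sub>L 'h) set" and Y :: "('k \<Rightarrow>\<^sub>L 'k) set"
  assumes "complex_hilbert_space smulH ipH" and "operator_space smulH X"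
    and "complex_hilbert_space smulK ipK" and "operator_space smulK Y"
    and "almost_completely_lipschitz_embeds (concrete_os smulH X) (dual_os (concrete_os smulK Y))"
  shows "almost_completely_linearly_embeds (concrete_os smulH X)
           (direct_sum_os (dual_os (concrete_os smulK Y)) (dual_os (conj_os smulK Y)))"
proof -
  interpret operator_space_pair smulH ipH X smulK ipK Y
    using assms(1-4)
    by (simp add: operator_space_pair_def concrete_operator_space_def concrete_operator_space_axioms_def)
  let ?Z = "direct_sum_os dualY (dual_os Yc.V)"
  obtain D f where D: "D > 0" and f: "amplifications_embed X.V dualY D f"
    using assms(5) unfolding almost_completely_lipschitz_embeds_def by blast
  define D' where "D' = 4 * (D + 1) + 2"
  have D': "D' > 0" using D by (simp add: D'_def)
  have "\<exists>h. h ` X \<subseteq> os_carrier ?Z \<and>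
      lipschitz_embedding (matrices n X.V) (matrix_dist n X.V) (matrices n ?Z) (matrix_dist n ?Z)
        (amplification n h) \<and>
      lipschitz_distortion (matrices n X.V) (matrix_dist n X.V) (matrix_dist n ?Z) (amplification n h) \<le> D' \<and>
      clinear_on X (op_smul smulH) (os_smul ?Z) h" if n: "n \<ge> 1" for n
  proof -
    \<comment> \<open>The order \<open>N\<close> of the amplification that is used must be large compared with \<open>n\<close>, so that the
      linearization error on \<open>n \<times> n\<close> matrices drops below \<open>r / 2\<close>.\<close>
    define C where "C = max (real n) ((8 * real n ^ 2 * (D + 1))\<^sup>2)"
    obtain k where "C < 2 ^ k" using real_arch_pow[of 2 C] by auto
    define N :: nat where "N = 2 ^ Suc k"
    have "0 \<le> C" by (simp add: C_def)
    then have "C \<le> real N" using \<open>C < 2 ^ k\<close> by (simp add: N_def)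
    then have nN: "n \<le> N" and "(8 * real n ^ 2 * (D + 1))\<^sup>2 \<le> real N" by (simp_all add: C_def)
    then have sqrt_N: "8 * real n ^ 2 * (D + 1) \<le> sqrt N" by (intro real_le_rsqrt)
    have N: "N \<ge> 1" by (simp add: N_def)
    have fN: "f N ` X \<subseteq> os_carrier dualY"
      using f N unfolding amplifications_embed_def by simp
    obtain E r where E: "0 < E" "E < D + 1" and r: "0 < r"
      and lower: "\<And>P Q. P \<in> matrices N X.V \<Longrightarrow> Q \<in> matrices N X.V \<Longrightarrow>
        r * matrix_dist N X.V P Q \<le> matrix_dist N dualY (amplification N (f N) P) (amplification N (f N) Q)"
      and upper: "\<And>P Q. P \<in> matrices N X.V \<Longrightarrow> Q \<in> matrices N X.V \<Longrightarrow>
        matrix_dist N dualY (amplification N (f N) P) (amplification N (f N) Q)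
          \<le> E * r * matrix_dist N X.V P Q"
    proof (rule lipschitz_embedding_bounds)
      show "lipschitz_embedding (matrices N X.V) (matrix_dist N X.V) (matrices N dualY)
          (matrix_dist N dualY) (amplification N (f N))"
        "lipschitz_distortion (matrices N X.V) (matrix_dist N X.V) (matrix_dist N dualY)
          (amplification N (f N)) \<le> D"
        using f N unfolding amplifications_embed_def by blast+
      show "0 \<le> matrix_dist N X.V P Q" for P Q by (simp add: matrix_dist_def X.os_norm_nonneg)
      show "0 \<le> matrix_dist N dualY (amplification N (f N) P) (amplification N (f N) Q)"
        if "P \<in> matrices N X.V" "Q \<in> matrices N X.V" for P Q
        unfolding matrix_dist_def by (rule dual_amplification_bounded(2)[OF fN that])
    qed (rule that; assumption)
    have Er: "0 \<le> E * r" using E r by simp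
    have lower': "\<forall>P\<in>matrices N X.V. \<forall>Q\<in>matrices N X.V. r * os_norm X.V N (P - Q)
        \<le> os_norm dualY N (amplification N (f N) P - amplification N (f N) Q)"
      using lower unfolding matrix_dist_def by blast
    have upper': "\<forall>P\<in>matrices N X.V. \<forall>Q\<in>matrices N X.V.
        os_norm dualY N (amplification N (f N) P - amplification N (f N) Q) \<le> E * r * os_norm X.V N (P - Q)"
      using upper unfolding matrix_dist_def by blast
    have small: "real n ^ 2 * (4 * (E * r) / sqrt N) \<le> r / 2"
    proof -
      have "8 * real n ^ 2 * E \<le> sqrt N"
        by (rule order_trans[OF mult_left_mono sqrt_N]) (use E in auto)
      then have "8 * real n ^ 2 * E * r \<le> sqrt N * r" using r by (intro mult_right_mono) auto
      moreover have "sqrt N > 0" using N by simp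
      ultimately show ?thesis by (simp add: field_simps)
    qed
    obtain h where h: "h ` X \<subseteq> os_carrier ?Z" "clinear_on X (op_smul smulH) (os_smul ?Z) h"
      and h_lower: "\<And>M. M \<in> matrices n X.V \<Longrightarrow> r / 4 * os_norm X.V n M \<le> os_norm ?Z n (amplification n h M)"
      and h_upper: "\<And>M. M \<in> matrices n X.V \<Longrightarrow>
        os_norm ?Z n (amplification n h M) \<le> (E * r + r / 2) * os_norm X.V n M"
      by (rule linear_approximant[where k = k, folded N_def, OF nN fN r Er lower' upper' small])
        (rule that; assumption)
    have h_diff: "amplification n h P - amplification n h Q = amplification n h (P - Q)"
      if PQ: "P \<in> matrices n X.V" "Q \<in> matrices n X.V" for P Q
    proof -
      have "h (x - y) + h y = h x" if "x \<in> X" "y \<in> X" for x y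
        using h(2) that X.diff_mem unfolding clinear_on_def by (metis diff_add_cancel)
      then have "h (x - y) = h x - h y" if "x \<in> X" "y \<in> X" for x y
        using that by (simp add: eq_diff_eq)
      then show ?thesis
        using X.matrices_mem[OF PQ(1)] X.matrices_mem[OF PQ(2)] by (simp add: amplification_def fun_eq_iff)
    qed
    have "lipschitz_embedding (matrices n X.V) (matrix_dist n X.V) (matrices n ?Z) (matrix_dist n ?Z)
        (amplification n h) \<and>
      lipschitz_distortion (matrices n X.V) (matrix_dist n X.V) (matrix_dist n ?Z) (amplification n h) \<le> D'"
    proof (rule lipschitz_embeddingI[where r = "r / 4"])
      show "amplification n h ` matrices n X.V \<subseteq> matrices n ?Z"
        using h(1) X.matrices_mem by (auto simp: matrices_def amplification_def)
      show "P = Q" if "P \<in> matrices n X.V" "Q \<in> matrices n X.V" "matrix_dist n X.V P Q \<le> 0" for P Q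
      proof (intro ext)
        fix i j
        show "P i j = Q i j"
        proof (cases "i < n \<and> j < n")
          case True
          have "norm ((P - Q) i j) \<le> 0"
            using X.os_norm_entry[OF conjunct1[OF True] conjunct2[OF True], of "P - Q"] that(3)
            unfolding matrix_dist_def by linarith
          then show ?thesis by simp
        qed (use that in \<open>auto simp: matrices_def\<close>)
      qed
      show "matrix_dist n X.V P P = 0" if "P \<in> matrices n X.V" for P
        using X.os_norm_nonneg[of n 0] X.os_norm_le[of 0 0 n] by (simp add: matrix_dist_def L2_set_def)
      show "r / 4 * matrix_dist n X.V P Q
          \<le> matrix_dist n ?Z (amplification n h P) (amplification n h Q)"
        if "P \<in> matrices n X.V" "Q \<in> matrices n X.V" for P Q
        unfolding matrix_dist_def h_diff[OF that] by (rule h_lower[OF X.matrices_diff[OF that]])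
      show "matrix_dist n ?Z (amplification n h P) (amplification n h Q)
          \<le> D' * (r / 4) * matrix_dist n X.V P Q"
        if "P \<in> matrices n X.V" "Q \<in> matrices n X.V" for P Q
      proof -
        have "E * r \<le> (D + 1) * r" using E r by simp
        then have "E * r + r / 2 \<le> D' * (r / 4)" by (simp add: D'_def algebra_simps)
        then show ?thesis
          unfolding matrix_dist_def h_diff[OF that]
          by (intro order_trans[OF h_upper[OF X.matrices_diff[OF that]]] mult_right_mono X.os_norm_nonneg)
      qed
    qed (use r D' in auto)
    then show ?thesis using h by blast
  qed
  then obtain h where h: "\<And>n. n \<ge> 1 \<Longrightarrow> h n ` X \<subseteq> os_carrier ?Z \<and>
      lipschitz_embedding (matrices n X.V) (matrix_dist n X.V) (matrices n ?Z) (matrix_dist n ?Z)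
        (amplification n (h n)) \<and>
      lipschitz_distortion (matrices n X.V) (matrix_dist n X.V) (matrix_dist n ?Z) (amplification n (h n)) \<le> D' \<and>
      clinear_on X (op_smul smulH) (os_smul ?Z) (h n)"
    by metis
  then have "amplifications_embed X.V ?Z D' h"
    unfolding amplifications_embed_def by simp
  then show ?thesis
    unfolding almost_completely_linearly_embeds_def conj_os_def using D' h by auto
qed

end
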